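(* Let $\{\theta_k,\ k\ge0\}$ be the stochastic process defined in the context, with step-size $\gamma>0$. For some $0<\ell\le\psi\le+\infty$, suppose that $\theta_0,\hat\theta\in\mathcal{M}_+(\ell,\psi)$ and $\gamma\le\ell^2$. Then for all $k\geq 1$, $$\mathbb{E}\left[\mathbf{1}_{\{\tau(\ell,\psi)>k\}}\|\theta_k-\hat\theta\|_F^2\right]\le\left(1-\frac{\gamma}{\psi^2}\right)^k\|\theta_0-\hat\theta\|_F^2+2\gamma^2\ell^{-2}(p+p^2)\sum_{j=1}^kN_j^{-1}\left(1-\frac{\gamma}{\psi^2}\right)^{k-j}.$$
   Context: $\mathcal{M}$ is the set of real symmetric $p\times p$ matrices with inner product $\langle A,B\rangle=\mathrm{Tr}(A'B)$ and Frobenius norm $\|A\|_F$; $\mathcal{M}_+\subset\mathcal{M}$ is the set of positive definite matrices, and $\lambda_{\min},\lambda_{\max}$ denote smallest and largest eigenvalues. $S$ is a fixed $p\times p$ symmetric positive semidefinite matrix; $\lambda>0$ and $\alpha\in(0,1]$ are fixed. For $0<\ell\le\psi\le\infty$, $\mathcal{M}_+(\ell,\psi)=\{\theta\in\mathcal{M}_+:\lambda_{\min}(\theta)\ge\ell,\ \lambda_{\max}(\theta)\le\psi\}$; when $\psi=\infty$, $\gamma/\psi^2$ means $0$ (and $0^0=1$). Let $f(\theta)=-\log\det\theta+\mathrm{Tr}(\theta S)$ for $\theta\in\mathcal{M}_+$, $g_\alpha(\theta)=\sum_{i,j}\left(\alpha\lambda|\theta_{ij}|+\frac{1-\alpha}{2}\lambda\theta_{ij}^2\right)$,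 $\phi_\alpha=f+g_\alpha$, and let $\hat\theta$ be the (unique) minimizer of $\phi_\alpha$ over $\mathcal{M}_+$. For $\theta\in\mathcal{M}$, $\mathrm{Prox}_\gamma(\theta;\alpha)=\operatorname{argmin}_{u\in\mathcal{M}}\left\{g_\alpha(u)+\frac{1}{2\gamma}\|u-\theta\|_F^2\right\}$. The process: $\{N_k,\ k\ge1\}$ is a sequence of positive integers and $\theta_0\in\mathcal{M}_+$ is fixed (deterministic). For $k\ge1$, conditionally on $\mathcal{F}_{k-1}=\sigma(\theta_0,\ldots,\theta_{k-1})$, generate $z_1,\ldots,z_{N_k}$ i.i.d. from $\mathbf{N}(0,\theta_{k-1}^{-1})$ on $\mathbb{R}^p$, set $\Sigma_k=\frac{1}{N_k}\sum_{j=1}^{N_k}z_jz_j'$, and $$\theta_k=\mathrm{Prox}_\gamma\left(\theta_{k-1}-\gamma(S-\Sigma_k);\alpha\right).$$ (The recursion is run as long as $\theta_{k-1}\in\mathcal{M}_+$; what happens after the first exit from $\mathcal{M}_+$ is irrelevant.) Finally $\tau(\ell,\psi)=\inf\{k\ge0:\theta_k\notin\mathcal{M}_+(\ell,\psi)\}$, with $\inf\emptyset=\infty$. *)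

theory Defs
  imports "HOL-Probability.Probability" "HOL-Library.Extended_Nat"
begin

section \<open>Real symmetric matrices\<close>

definition sym_mats :: "(real^'p^'p) set" where
  "sym_mats = {A. transpose A = A}"

definition psd_mats :: "(real^'p^'p) set" where
  "psd_mats = {A \<in> sym_mats. \<forall>x. 0 \<le> x \<bullet> (A *v x)}"

definition pd_mats :: "(real^'p^'p) set" where
  "pd_mats = {A \<in> sym_mats. \<forall>x. x \<noteq> 0 \<longrightarrow> 0 < x \<bullet> (A *v x)}"

definition eigenvalues :: "real^'p^'p \<Rightarrow> real set" where
  "eigenvalues A = {c. \<exists>v. v \<noteq> 0 \<and> A *v v = c *\<^sub>R v}"

text \<open>For a symmetric matrix the set of eigenvalues is finite and nonempty, so
  \<^const>\<open>Min\<close> and \<^const>\<open>Max\<close> are meaningful; the two functions are only used there.\<close>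

definition lambda_min :: "real^'p^'p \<Rightarrow> real" where
  "lambda_min A = Min (eigenvalues A)"

definition lambda_max :: "real^'p^'p \<Rightarrow> real" where
  "lambda_max A = Max (eigenvalues A)"

definition pd_mats_between :: "real \<Rightarrow> ereal \<Rightarrow> (real^'p^'p) set" where
  "pd_mats_between l \<psi> =
     {\<theta> \<in> pd_mats. l \<le> lambda_min \<theta> \<and> ereal (lambda_max \<theta>) \<le> \<psi>}"

definition frob_inner :: "real^'p^'p \<Rightarrow> real^'p^'p \<Rightarrow> real" where
  "frob_inner A B = trace (transpose A ** B)"

definition frob_norm :: "real^'p^'p \<Rightarrow> real" where
  "frob_norm A = sqrt (frob_inner A A)"

lemma frob_inner_eq_inner: "frob_inner A B = A \<bullet> B"
proof -
  have "frob_inner A B = (\<Sum>i\<in>UNIV. \<Sum>k\<in>UNIV. A $ k $ i * B $ k $ i)"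
    by (simp add: frob_inner_def trace_def matrix_matrix_mult_def transpose_def)
  also have "\<dots> = (\<Sum>k\<in>UNIV. \<Sum>i\<in>UNIV. A $ k $ i * B $ k $ i)"
    by (rule sum.swap)
  finally show ?thesis by (simp add: inner_vec_def)
qed

lemma frob_norm_eq_norm: "frob_norm A = norm A"
  by (simp add: frob_norm_def frob_inner_eq_inner norm_eq_sqrt_inner)

section \<open>The objective and the proximal map\<close>

definition neg_loglik :: "real^'p^'p \<Rightarrow> real^'p^'p \<Rightarrow> real" where
  "neg_loglik S \<theta> = - ln (det \<theta>) + trace (\<theta> ** S)"

definition elastic_net :: "real \<Rightarrow> real \<Rightarrow> real^'p^'p \<Rightarrow> real" where
  "elastic_net lam \<alpha> \<theta> =
     (\<Sum>i\<in>UNIV. \<Sum>j\<in>UNIV. \<alpha> * lam * \<bar>\<theta> $ i $ j\<bar> + (1 - \<alpha>) / 2 * lam * (\<theta> $ i $ j)\<^sup>2)"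

definition objective :: "real^'p^'p \<Rightarrow> real \<Rightarrow> real \<Rightarrow> real^'p^'p \<Rightarrow> real" where
  "objective S lam \<alpha> \<theta> = neg_loglik S \<theta> + elastic_net lam \<alpha> \<theta>"

definition prox :: "real \<Rightarrow> real \<Rightarrow> real \<Rightarrow> real^'p^'p \<Rightarrow> real^'p^'p" where
  "prox \<gamma> lam \<alpha> \<theta> =
     arg_min_on (\<lambda>u. elastic_net lam \<alpha> u + 1 / (2 * \<gamma>) * (frob_norm (u - \<theta>))\<^sup>2) sym_mats"

section \<open>Gaussian sampling\<close>

text \<open>The centred normal law with positive definite covariance matrix \<open>C\<close>.\<close>

definition gaussian :: "real^'p^'p \<Rightarrow> (real^'p) measure" where
  "gaussian C = density lborel (\<lambda>x. ennreal
     (exp (- (1 / 2) * (x \<bullet> (matrix_inv C *v x))) / sqrt ((2 * pi) ^ CARD('p) * det C)))"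

definition outer_square :: "real^'p \<Rightarrow> real^'p^'p" where
  "outer_square x = (\<chi> i j. x $ i * x $ j)"

definition sample_cov :: "nat \<Rightarrow> (nat \<Rightarrow> real^'p) \<Rightarrow> real^'p^'p" where
  "sample_cov n x = (1 / real n) *\<^sub>R (\<Sum>j = 1..n. outer_square (x j))"

section \<open>The stochastic proximal gradient process\<close>

definition history :: "'a measure \<Rightarrow> (nat \<Rightarrow> 'a \<Rightarrow> real^'p^'p) \<Rightarrow> nat \<Rightarrow> 'a measure" where
  "history M \<theta> k = sigma (space M) {\<theta> i -` A \<inter> space M | i A. i \<le> k \<and> A \<in> sets borel}"

text \<open>\<open>z k 1, \<dots>, z k (N k)\<close> are the draws used in step \<open>k\<close>. Assumption \<open>draws\<close> says that,
  conditionally on the past, they are i.i.d.\ with law \<^term>\<open>gaussian (matrix_inv (\<theta> (k - 1) \<omega>))\<close>: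
  the conditional probability of any measurable rectangle is the product of the marginal
  probabilities. Both \<open>draws\<close> and \<open>recursion\<close> only constrain the process up to its first exit
  from the positive definite matrices.\<close>

locale stoch_prox_process = prob_space M
  for M :: "'a measure"
    and S :: "real^'p^'p" and lam \<alpha> \<gamma> :: real and N :: "nat \<Rightarrow> nat"
    and \<theta>0 :: "real^'p^'p"
    and \<theta> :: "nat \<Rightarrow> 'a \<Rightarrow> real^'p^'p"
    and z :: "nat \<Rightarrow> nat \<Rightarrow> 'a \<Rightarrow> real^'p" +
  assumes N_pos: "\<And>k. k \<ge> 1 \<Longrightarrow> N k \<ge> 1"
    and \<theta>0_pd: "\<theta>0 \<in> pd_mats"
    and \<theta>_measurable: "\<And>k. \<theta> k \<in> borel_measurable M"
    and z_measurable: "\<And>k j. k \<ge> 1 \<Longrightarrow> j \<in> {1..N k} \<Longrightarrow> z k j \<in> borel_measurable M"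
    and init: "\<And>\<omega>. \<omega> \<in> space M \<Longrightarrow> \<theta> 0 \<omega> = \<theta>0"
    and draws: "\<And>k A. k \<ge> 1 \<Longrightarrow> (\<And>j. j \<in> {1..N k} \<Longrightarrow> A j \<in> sets borel) \<Longrightarrow>
      AE \<omega> in M. (\<forall>i<k. \<theta> i \<omega> \<in> pd_mats) \<longrightarrow>
        real_cond_exp M (history M \<theta> (k - 1))
          (indicat_real {\<omega> \<in> space M. \<forall>j\<in>{1..N k}. z k j \<omega> \<in> A j}) \<omega> =
        (\<Prod>j = 1..N k. measure (gaussian (matrix_inv (\<theta> (k - 1) \<omega>))) (A j))"
    and recursion: "\<And>k \<omega>. k \<ge> 1 \<Longrightarrow> \<omega> \<in> space M \<Longrightarrow> (\<forall>i<k. \<theta> i \<omega> \<in> pd_mats) \<Longrightarrow>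
      \<theta> k \<omega> = prox \<gamma> lam \<alpha>
        (\<theta> (k - 1) \<omega> - \<gamma> *\<^sub>R (S - sample_cov (N k) (\<lambda>j. z k j \<omega>)))"

text \<open>The infimum of the empty set in \<^typ>\<open>enat\<close> is \<open>\<infinity>\<close>.\<close>

definition exit_time :: "(nat \<Rightarrow> 'a \<Rightarrow> real^'p^'p) \<Rightarrow> real \<Rightarrow> ereal \<Rightarrow> 'a \<Rightarrow> enat" where
  "exit_time \<theta> l \<psi> \<omega> = (INF k \<in> {k. \<theta> k \<omega> \<notin> pd_mats_between l \<psi>}. enat k)"

text \<open>The factor \<open>1 - \<gamma> / \<psi>\<^sup>2\<close>; in \<^typ>\<open>ereal\<close> the quotient is \<open>0\<close> for \<open>\<psi> = \<infinity>\<close>.\<close>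

definition contraction :: "real \<Rightarrow> ereal \<Rightarrow> real" where
  "contraction \<gamma> \<psi> = 1 - real_of_ereal (ereal \<gamma> / \<psi>\<^sup>2)"

lemma contraction_ereal [simp]: "0 < r \<Longrightarrow> contraction \<gamma> (ereal r) = 1 - \<gamma> / r\<^sup>2"
  by (simp add: contraction_def)

lemma contraction_infty [simp]: "contraction \<gamma> \<infinity> = 1"
  by (simp add: contraction_def power2_eq_square)

end

(* Both the iterate and the minimiser are proximal points, the minimiser being a fixed point of
   the exact proximal gradient step. Nonexpansiveness of the proximal map therefore bounds the
   new error by the norm of
     (theta_(k-1) - thetahat) + gamma (theta_(k-1)^-1 - thetahat^-1) + gamma (Sigma_k - theta_(k-1)^-1).
   In eigenbases of the two matrices the first two terms act entrywise as multiplication by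
   1 - gamma / (d_i e_j), which lies between 0 and 1 - gamma / psi^2. The last term is centred
   given the past, so the cross term vanishes in conditional expectation, and its second moment
   is at most gamma^2 / N_k times the fourth moment of N(0, theta_(k-1)^-1). Iterating the
   resulting recursion for the stopped error gives the bound. *)

theory Submission
  imports Defs
begin

section \<open>The spectral theorem for real symmetric matrices\<close>

text \<open>The current iterate and the minimiser need not commute, so there is no common
  eigenbasis. The identity A^-1 - B^-1 = -A^-1 (A - B) B^-1 gets round this: with an eigenbasis of A
  on the left and one of B on the right the step becomes diagonal, and the Frobenius norm ignores
  both rotations. On the random side the obstacle is that the law of the draws is given only through
  conditional probabilities of rectangles, and only while the past is positive definite. Written as
  a density in the precision matrix against a fixed Lebesgue product, the normal law is a measurable
  kernel; comparing two measures on rectangles then yields conditional integrals of arbitrary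
  nonnegative functions. Survival through step k is not decided at time k-1. The indicator is
  therefore enlarged to survival through k-1, an event of the past on which the spectrum of the
  iterate is controlled. Errors are kept as extended nonnegative integrals, so the recursion carries
  no integrability claims.\<close>

text \<open>A function of \<open>t\<close> that vanishes at 0 and is never positive has a maximum
  there, so its slope \<open>2 * a\<close> is zero. This is the first-order condition that makes a
  maximiser of the quadratic form an eigenvector.\<close>

lemma quadratic_nonpos_linear_coeff_zero:
  fixes a b :: real
  assumes "\<And>t. 2 * t * a + t\<^sup>2 * b \<le> 0"
  shows "a = 0"
proof -
  \<comment> \<open>The damping keeps \<open>1 + s * b\<close> nonnegative. At
    \<open>t = a * s\<close> the hypothesis reads a^2 s (2 + s b) \<le> 0, which forces a^2 s \<le>
    0.\<close>
  define s where "s = 1 / (1 + \<bar>b\<bar>)"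
  have s: "0 < s" "s * \<bar>b\<bar> \<le> 1" by (auto simp: s_def field_simps)
  have "0 \<le> a\<^sup>2 * s * (1 + s * b)"
    using s abs_le_D2[of "s * b" 1] by (auto simp: abs_mult)
  moreover have "2 * a\<^sup>2 * s + a\<^sup>2 * s\<^sup>2 * b \<le> 0"
    using assms[of "a * s"] by (simp add: power2_eq_square algebra_simps)
  ultimately have "a\<^sup>2 * s \<le> 0" by (simp add: power2_eq_square algebra_simps)
  then show "a = 0" using s by (simp add: mult_le_0_iff)
qed

lemma symmetric_matrix_inner_swap:
  fixes A :: "real^'n^'n"
  assumes "transpose A = A"
  shows "x \<bullet> (A *v y) = y \<bullet> (A *v x)"
  by (metis assms dot_lmul_matrix inner_commute vector_transpose_matrix)

text \<open>The quadratic form attains its maximum on the compact unit sphere of \<open>V\<close>,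
  and a maximiser is an eigenvector whose eigenvalue is the maximum itself.\<close>

lemma symmetric_matrix_eigenvector:
  fixes A :: "real^'n^'n"
  assumes sym: "transpose A = A" and V: "subspace V" "\<And>x. x \<in> V \<Longrightarrow> A *v x \<in> V" and "V \<noteq> {0}"
  shows "\<exists>v\<in>V. norm v = 1 \<and> A *v v = (v \<bullet> (A *v v)) *\<^sub>R v"
proof -
  obtain x where x: "x \<in> V" "x \<noteq> 0" using assms subspace_0 by blast
  have "compact (V \<inter> sphere 0 1)"
    using closed_subspace[OF V(1)] by (simp add: closed_Int_compact)
  moreover have "x /\<^sub>R norm x \<in> V \<inter> sphere 0 1"
    using x V(1) by (simp add: subspace_scale)
  moreover have "continuous_on (V \<inter> sphere 0 1) (\<lambda>x. x \<bullet> (A *v x))"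
    by (intro continuous_intros)
  ultimately obtain v where v: "v \<in> V" "norm v = 1"
    and mx: "\<And>y. y \<in> V \<Longrightarrow> norm y = 1 \<Longrightarrow> y \<bullet> (A *v y) \<le> v \<bullet> (A *v v)"
    using continuous_attains_sup[of "V \<inter> sphere 0 1" "\<lambda>x. x \<bullet> (A *v x)"]
    by (metis Int_iff empty_iff mem_sphere_0)
  define c where "c = v \<bullet> (A *v v)"
  have le: "y \<bullet> (A *v y) \<le> c * (y \<bullet> y)" if "y \<in> V" for y
  proof (cases "y = 0")
    case False
    have "(y /\<^sub>R norm y) \<bullet> (A *v (y /\<^sub>R norm y)) \<le> c"
      unfolding c_def by (rule mx) (use that False V(1) in \<open>auto simp: subspace_scale\<close>)
    then show ?thesis
      using False by (simp add: matrix_vector_mult_scaleR field_simps power2_norm_eq_inner[symmetric] power2_eq_square)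
  qed simp
  \<comment> \<open>Invariance of \<open>V\<close> makes the residual an admissible direction;
    perturbing \<open>v\<close> along it turns maximality into
    \<open>w \<bullet> w = 0\<close>.\<close>
  define w where "w = A *v v - c *\<^sub>R v"
  have wV: "w \<in> V" unfolding w_def using V v by (simp add: subspace_diff subspace_scale)
  have vv: "v \<bullet> v = 1" using v by (simp add: norm_eq_1)
  have "w \<bullet> (A *v v) - c * (w \<bullet> v) = 0"
  proof (rule quadratic_nonpos_linear_coeff_zero)
    fix t
    have "(v + t *\<^sub>R w) \<bullet> (A *v (v + t *\<^sub>R w)) \<le> c * ((v + t *\<^sub>R w) \<bullet> (v + t *\<^sub>R w))"
      by (rule le) (use V v wV in \<open>simp add: subspace_add subspace_scale\<close>)
    then show "2 * t * (w \<bullet> (A *v v) - c * (w \<bullet> v)) + t\<^sup>2 * (w \<bullet> (A *v w) - c * (w \<bullet> w)) \<le> 0"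
      using symmetric_matrix_inner_swap[OF sym, of v w] vv
      by (simp add: matrix_vector_right_distrib matrix_vector_mult_scaleR inner_add_left inner_add_right
          inner_commute[of v w] c_def[symmetric] power2_eq_square algebra_simps)
  qed
  then have "w \<bullet> w = 0" by (simp add: w_def inner_diff_right)
  then have "A *v v = c *\<^sub>R v" by (simp add: w_def)
  with v c_def show ?thesis by auto
qed

text \<open>By symmetry, the orthogonal complement of an eigenvector inside an invariant subspace is
  again invariant, and it has one dimension less; hence the induction over invariant subspaces
  rather than over matrices.\<close>

lemma symmetric_matrix_orthonormal_eigenvectors:
  fixes A :: "real^'n^'n"
  assumes sym: "transpose A = A"
  shows "subspace V \<Longrightarrow> (\<And>x. x \<in> V \<Longrightarrow> A *v x \<in> V) \<Longrightarrow>
    \<exists>B\<subseteq>V. finite B \<and> card B = dim V \<and> pairwise orthogonal B \<and>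
      (\<forall>b\<in>B. norm b = 1 \<and> A *v b = (b \<bullet> (A *v b)) *\<^sub>R b)"
proof (induction "dim V" arbitrary: V)
  case 0
  then show ?case by (intro exI[of _ "{}"]) auto
next
  case (Suc n)
  have "V \<noteq> {0}" using Suc.hyps(2) by auto
  with symmetric_matrix_eigenvector[OF sym Suc.prems]
  obtain v where v: "v \<in> V" "norm v = 1" "A *v v = (v \<bullet> (A *v v)) *\<^sub>R v" by blast
  define W where "W = {y \<in> V. \<forall>x\<in>span {v}. orthogonal x y}"
  have W: "W = {y \<in> V. v \<bullet> y = 0}"
    unfolding W_def by (auto simp: span_singleton orthogonal_def intro: exI[of _ 1])
  have "dim W + dim (span {v}) = dim V"
    unfolding W_def using v Suc.prems by (intro dim_subspace_orthogonal_to_vectors) (auto simp: span_minimal)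
  moreover have "dim (span {v}) = 1" using v by (auto simp: dim_insert)
  ultimately have dW: "n = dim W" using Suc.hyps(2) by simp
  have sW: "subspace W" using Suc.prems(1) unfolding W by (auto simp: subspace_def inner_add_right)
  have AW: "A *v x \<in> W" if "x \<in> W" for x
  proof -
    have "v \<bullet> (A *v x) = x \<bullet> (A *v v)" by (rule symmetric_matrix_inner_swap[OF sym])
    also have "\<dots> = (v \<bullet> (A *v v)) * (x \<bullet> v)" by (subst v(3)) simp
    also have "\<dots> = 0" using that by (simp add: W inner_commute)
    finally show ?thesis using that Suc.prems(2) by (simp add: W)
  qed
  obtain B where B: "B \<subseteq> W" "finite B" "card B = dim W" "pairwise orthogonal B"
    "\<forall>b\<in>B. norm b = 1 \<and> A *v b = (b \<bullet> (A *v b)) *\<^sub>R b"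
    using Suc.hyps(1)[OF dW sW AW] by blast
  have "v \<notin> B" using B(1) v by (auto simp: W norm_eq_1)
  moreover have "pairwise orthogonal (insert v B)"
    using B(1,4) by (auto simp: pairwise_insert orthogonal_def W inner_commute)
  ultimately show ?case
    using B v Suc.hyps(2) dW by (intro exI[of _ "insert v B"]) (auto simp: W)
qed

definition diag_mat :: "real^'n \<Rightarrow> real^'n^'n" where
  "diag_mat d = (\<chi> i j. if i = j then d $ i else 0)"

theorem symmetric_matrix_spectral:
  fixes A :: "real^'n^'n"
  assumes sym: "transpose A = A"
  obtains Q d where "orthogonal_matrix Q" "A = Q ** diag_mat d ** transpose Q"
proof -
  obtain B where B: "finite B" "card B = dim (UNIV :: (real^'n) set)" "pairwise orthogonal B"
    "\<forall>b\<in>B. norm b = 1 \<and> A *v b = (b \<bullet> (A *v b)) *\<^sub>R b"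
    using symmetric_matrix_orthonormal_eigenvectors[OF sym, of UNIV] by auto
  have "card B = CARD('n)" using B by simp
  then obtain f :: "'n \<Rightarrow> real^'n" where f: "bij_betw f UNIV B"
    using B(1) finite_same_card_bij[of "UNIV :: 'n set" B] by auto
  define Q :: "real^'n^'n" where "Q = (\<chi> i j. f j $ i)"
  define d :: "real^'n" where "d = (\<chi> j. f j \<bullet> (A *v f j))"
  have col: "column j Q = f j" for j by (simp add: column_def Q_def vec_eq_iff)
  have fB: "f j \<in> B" for j using f by (auto simp: bij_betw_def)
  have Q: "orthogonal_matrix Q"
    unfolding orthogonal_matrix_orthonormal_columns col
    using fB B(3,4) f by (auto simp: pairwise_def bij_betw_def inj_on_def orthogonal_def) metis
  have "A ** Q = Q ** diag_mat d"
  proof -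
    have "(A ** Q) $ i $ j = (Q ** diag_mat d) $ i $ j" for i j
    proof -
      have "(A ** Q) $ i $ j = (A *v f j) $ i"
        by (simp add: matrix_matrix_mult_def matrix_vector_mult_def Q_def)
      also have "\<dots> = (d $ j *\<^sub>R f j) $ i" using B(4) fB by (simp add: d_def)
      also have "\<dots> = (Q ** diag_mat d) $ i $ j"
        by (simp add: matrix_matrix_mult_def Q_def diag_mat_def if_distrib cong: if_cong)
      finally show ?thesis .
    qed
    then show ?thesis by (simp add: vec_eq_iff)
  qed
  then have "A = Q ** diag_mat d ** transpose Q"
    using Q by (metis matrix_mul_assoc matrix_mul_rid orthogonal_matrix_def)
  with Q that show thesis by blast
qed

text \<open>This rewriting would turn \<open>transpose Q *v x\<close> into a row-vector product and
  hide the pattern on which the cancellation rules below rely.\<close>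

declare transpose_matrix_vector [simp del]

section \<open>Calculus of matrices of the form Q diag(d) Q^T\<close>

lemma diag_mat_mult_vec: "(diag_mat d *v x) $ i = d $ i * x $ i"
  by (simp add: diag_mat_def matrix_vector_mult_def if_distrib[of "\<lambda>c. c * _"] cong: if_cong)

lemma diag_mat_mult_diag_mat: "diag_mat d ** diag_mat e = diag_mat (\<chi> i. d $ i * e $ i)"
  by (simp add: diag_mat_def matrix_matrix_mult_def vec_eq_iff if_distrib[of "\<lambda>c. c * _"] cong: if_cong)

lemma diag_mat_one: "diag_mat (\<chi> i. 1) = mat 1"
  by (simp add: diag_mat_def mat_def vec_eq_iff)

lemma det_diag_mat: "det (diag_mat d) = (\<Prod>i\<in>UNIV. d $ i)"
  by (subst det_diagonal) (auto simp: diag_mat_def)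

lemma transpose_diag_mat: "transpose (diag_mat d) = diag_mat d"
  by (auto simp: diag_mat_def transpose_def vec_eq_iff)

lemma orthogonal_matrix_cancel:
  fixes Q :: "real^'n^'n"
  assumes "orthogonal_matrix Q"
  shows "transpose Q ** Q = mat 1" "Q ** transpose Q = mat 1"
    "transpose Q ** (Q ** X) = X" "Q ** (transpose Q ** X) = X"
    "transpose Q *v (Q *v x) = x" "Q *v (transpose Q *v x) = x"
  using assms by (simp_all add: orthogonal_matrix_def matrix_mul_assoc matrix_vector_mul_assoc)

lemma norm_orthogonal_matrix_mult_vec:
  fixes Q :: "real^'n^'n"
  assumes "orthogonal_matrix Q"
  shows "norm (Q *v x) = norm x"
  using assms orthogonal_transformation_matrix[of "\<lambda>x. Q *v x"]
  by (simp add: orthogonal_transformation)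

lemma quadratic_form_spectral:
  fixes Q :: "real^'n^'n"
  shows "x \<bullet> ((Q ** diag_mat d ** transpose Q) *v x) = (\<Sum>i\<in>UNIV. d $ i * ((transpose Q *v x) $ i)\<^sup>2)"
proof -
  have "x \<bullet> ((Q ** diag_mat d ** transpose Q) *v x) = (transpose Q *v x) \<bullet> (diag_mat d *v (transpose Q *v x))"
    by (metis dot_lmul_matrix matrix_vector_mul_assoc transpose_matrix_vector)
  then show ?thesis
    by (simp add: inner_vec_def diag_mat_mult_vec power2_eq_square mult_ac)
qed

text \<open>Exhibits the eigenvalues as a finite nonempty set, so that \<open>lambda_min\<close> and
  \<open>lambda_max\<close> are genuine extremes of the entries of \<open>d\<close>.\<close>

lemma eigenvalues_spectral:
  fixes Q :: "real^'n^'n"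
  assumes Q: "orthogonal_matrix Q"
  shows "eigenvalues (Q ** diag_mat d ** transpose Q) = range (($) d)"
proof (intro equalityI subsetI)
  fix c assume "c \<in> eigenvalues (Q ** diag_mat d ** transpose Q)"
  then obtain v where v: "v \<noteq> 0" "(Q ** diag_mat d ** transpose Q) *v v = c *\<^sub>R v"
    by (auto simp: eigenvalues_def)
  define y where "y = transpose Q *v v"
  have vy: "v = Q *v y" using Q by (simp add: y_def orthogonal_matrix_cancel)
  have "transpose Q *v (Q *v (diag_mat d *v y)) = transpose Q *v (Q *v (c *\<^sub>R y))"
    using v(2) unfolding y_def matrix_vector_mul_assoc[symmetric]
    by (simp add: matrix_vector_mult_scaleR orthogonal_matrix_cancel Q)
  then have eq: "diag_mat d *v y = c *\<^sub>R y" by (simp add: orthogonal_matrix_cancel Q)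
  have "y \<noteq> 0" using v(1) vy by auto
  then obtain i where i: "y $ i \<noteq> 0" by (auto simp: vec_eq_iff)
  have "d $ i * y $ i = c * y $ i" using eq by (metis diag_mat_mult_vec vector_scaleR_component real_scaleR_def)
  with i show "c \<in> range (($) d)" by (metis (full_types) mult_cancel_right rangeI)
next
  fix c assume "c \<in> range (($) d)"
  then obtain i where c: "c = d $ i" by auto
  have "diag_mat d *v axis i 1 = c *\<^sub>R axis i 1"
    by (simp add: vec_eq_iff diag_mat_mult_vec axis_def c)
  then have "(Q ** diag_mat d ** transpose Q) *v (Q *v axis i 1) = c *\<^sub>R (Q *v axis i 1)"
    by (simp add: matrix_vector_mul_assoc[symmetric] orthogonal_matrix_cancel Q matrix_vector_mult_scaleR)
  moreover have "Q *v axis i 1 \<noteq> 0"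
    using norm_orthogonal_matrix_mult_vec[OF Q, of "axis i 1"] by (auto simp: norm_axis_1)
  ultimately show "c \<in> eigenvalues (Q ** diag_mat d ** transpose Q)"
    by (auto simp: eigenvalues_def)
qed

lemma sym_mats_spectral:
  assumes "A \<in> sym_mats"
  obtains Q d where "orthogonal_matrix Q" "A = Q ** diag_mat d ** transpose Q"
  using assms symmetric_matrix_spectral unfolding sym_mats_def by blast

lemma pd_mats_spectral_pos:
  assumes A: "A \<in> pd_mats" and Q: "orthogonal_matrix Q" and eq: "A = Q ** diag_mat d ** transpose Q"
  shows "0 < d $ i"
proof -
  have "d $ i \<in> eigenvalues A" using eigenvalues_spectral[OF Q, of d] eq by auto
  then obtain v where v: "v \<noteq> 0" "A *v v = d $ i *\<^sub>R v" by (auto simp: eigenvalues_def)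
  then have "0 < v \<bullet> (A *v v)" using A by (auto simp: pd_mats_def)
  then show ?thesis using v inner_ge_zero[of v] by (auto simp: zero_less_mult_iff)
qed

lemma pd_mats_between_spectral:
  assumes A: "A \<in> pd_mats_between l \<psi>" and Q: "orthogonal_matrix Q"
    and eq: "A = Q ** diag_mat d ** transpose Q"
  shows "l \<le> d $ i" "ereal (d $ i) \<le> \<psi>"
proof -
  have "lambda_min A \<le> d $ i" "d $ i \<le> lambda_max A"
    unfolding lambda_min_def lambda_max_def eq eigenvalues_spectral[OF Q] by auto
  then show "l \<le> d $ i" "ereal (d $ i) \<le> \<psi>"
    using A order_trans[of "ereal (d $ i)" "ereal (lambda_max A)" \<psi>]
    by (auto simp: pd_mats_between_def)
qed

lemma spectral_in_pd_mats:
  assumes Q: "orthogonal_matrix Q" and d: "\<And>i. 0 < d $ i"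
  shows "Q ** diag_mat d ** transpose Q \<in> pd_mats"
proof -
  have "0 < (\<Sum>i\<in>UNIV. d $ i * ((transpose Q *v x) $ i)\<^sup>2)" if "x \<noteq> 0" for x
  proof -
    have "transpose Q *v x \<noteq> 0"
      using that orthogonal_matrix_cancel(6)[OF Q, of x] by auto
    then obtain i where "(transpose Q *v x) $ i \<noteq> 0" by (auto simp: vec_eq_iff)
    then show ?thesis using d
      by (intro sum_pos2[of UNIV i]) (simp_all add: less_imp_le)
  qed
  then show ?thesis
    unfolding pd_mats_def sym_mats_def
    by (simp add: quadratic_form_spectral matrix_transpose_mul transpose_diag_mat matrix_mul_assoc)
qed

section \<open>Inverses and determinants of positive definite matrices\<close>

lemma matrix_inv_eqI:
  fixes A B :: "real^'n^'n"
  assumes "A ** B = mat 1"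
  shows "matrix_inv A = B"
proof -
  have BA: "B ** A = mat 1" using assms matrix_left_right_inverse by blast
  have "invertible A" using assms BA invertible_def by blast
  then have "A ** matrix_inv A = mat 1" unfolding matrix_inv_def invertible_def
    by (metis (mono_tags, lifting) someI_ex)
  then show ?thesis
    by (metis BA matrix_mul_assoc matrix_mul_lid matrix_mul_rid)
qed

lemma spectral_mult:
  fixes Q :: "real^'n^'n"
  assumes "orthogonal_matrix Q"
  shows "Q ** diag_mat d ** transpose Q ** (Q ** diag_mat e ** transpose Q)
    = Q ** diag_mat (\<chi> i. d $ i * e $ i) ** transpose Q"
  using assms
  by (simp add: matrix_mul_assoc[symmetric] orthogonal_matrix_cancel)
    (simp add: matrix_mul_assoc diag_mat_mult_diag_mat[symmetric])

lemma matrix_inv_spectral: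
  fixes Q :: "real^'n^'n"
  assumes Q: "orthogonal_matrix Q" and d: "\<And>i. d $ i \<noteq> 0"
  shows "matrix_inv (Q ** diag_mat d ** transpose Q) = Q ** diag_mat (\<chi> i. 1 / d $ i) ** transpose Q"
  using d by (intro matrix_inv_eqI)
    (simp add: spectral_mult Q diag_mat_one orthogonal_matrix_cancel)

lemma matrix_inv_pd:
  assumes "A \<in> pd_mats"
  shows "matrix_inv A \<in> pd_mats" "A ** matrix_inv A = mat 1" "matrix_inv A ** A = mat 1"
    "matrix_inv (matrix_inv A) = A" "0 < det A" "det (matrix_inv A) = 1 / det A"
proof -
  obtain Q d where Q: "orthogonal_matrix Q" and A: "A = Q ** diag_mat d ** transpose Q"
    using assms sym_mats_spectral by (auto simp: pd_mats_def)
  note d = pd_mats_spectral_pos[OF assms Q A]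
  have inv: "matrix_inv A = Q ** diag_mat (\<chi> i. 1 / d $ i) ** transpose Q"
    unfolding A by (rule matrix_inv_spectral[OF Q]) (use d in \<open>simp add: less_imp_neq[symmetric]\<close>)
  show "matrix_inv A \<in> pd_mats"
    unfolding inv by (rule spectral_in_pd_mats[OF Q]) (use d in simp)
  show AB: "A ** matrix_inv A = mat 1"
    unfolding inv unfolding A
    using d by (simp add: spectral_mult Q diag_mat_one orthogonal_matrix_cancel less_imp_neq[symmetric])
  then show BA: "matrix_inv A ** A = mat 1" using matrix_left_right_inverse by blast
  show "matrix_inv (matrix_inv A) = A" by (rule matrix_inv_eqI[OF BA])
  have "det (transpose Q) * det Q = 1"
    using orthogonal_matrix_cancel(1)[OF Q] by (metis det_I det_mul)
  then have "det A = (\<Prod>i\<in>UNIV. d $ i)" unfolding A by (simp add: det_mul det_diag_mat)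
  then show dA: "0 < det A" using d by (simp add: prod_pos)
  have "det A * det (matrix_inv A) = 1" using AB by (metis det_I det_mul)
  then show "det (matrix_inv A) = 1 / det A" using dA by (simp add: field_simps)
qed

text \<open>For fixed \<open>x\<close>, quadratic-form inequalities are linear in \<open>A\<close>,
  unlike conditions on eigenvalues. The upper bound ranges over all real \<open>r\<close> above
  \<psi>, so an infinite \<psi> imposes nothing and needs no separate statement.\<close>

lemma pd_mats_between_iff:
  fixes A :: "real^'n^'n"
  assumes l: "0 < l"
  shows "A \<in> pd_mats_between l \<psi> \<longleftrightarrow> A \<in> sym_mats \<and> (\<forall>x. l * (x \<bullet> x) \<le> x \<bullet> (A *v x)) \<and>
    (\<forall>r x. \<psi> \<le> ereal r \<longrightarrow> x \<bullet> (A *v x) \<le> r * (x \<bullet> x))"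
proof (cases "A \<in> sym_mats")
  case True
  then obtain Q d where Q: "orthogonal_matrix Q" and A: "A = Q ** diag_mat d ** transpose Q"
    using sym_mats_spectral by blast
  have norm: "x \<bullet> x = (\<Sum>i\<in>UNIV. ((transpose Q *v x) $ i)\<^sup>2)" for x
  proof -
    have "norm x = norm (transpose Q *v x)"
      using Q by (simp add: norm_orthogonal_matrix_mult_vec)
    then show ?thesis by (simp add: norm_eq inner_vec_def power2_eq_square)
  qed
  have ev: "\<exists>v. v \<bullet> v = 1 \<and> v \<bullet> (A *v v) = d $ i" for i
  proof (intro exI conjI)
    let ?v = "Q *v axis i 1"
    have "transpose Q *v ?v = axis i 1" using Q by (simp add: orthogonal_matrix_cancel)
    then show "?v \<bullet> ?v = 1" "?v \<bullet> (A *v ?v) = d $ i"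
      unfolding A quadratic_form_spectral norm
      by (simp_all add: axis_def if_distrib[of "\<lambda>c. _ * c"] if_distrib[of "\<lambda>c. c\<^sup>2"] cong: if_cong)
  qed
  show ?thesis
  proof safe
    fix x assume *: "A \<in> pd_mats_between l \<psi>"
    have "l \<le> d $ i" for i by (rule pd_mats_between_spectral(1)[OF * Q A])
    then show "l * (x \<bullet> x) \<le> x \<bullet> (A *v x)"
      unfolding norm unfolding A quadratic_form_spectral sum_distrib_left
      by (intro sum_mono mult_right_mono) auto
  next
    fix x r assume *: "A \<in> pd_mats_between l \<psi>" and "\<psi> \<le> ereal r"
    have "d $ i \<le> r" for i
      using pd_mats_between_spectral(2)[OF * Q A, of i] \<open>\<psi> \<le> ereal r\<close>
      by (metis ereal_less_eq(3) order_trans)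
    then show "x \<bullet> (A *v x) \<le> r * (x \<bullet> x)"
      unfolding norm unfolding A quadratic_form_spectral sum_distrib_left
      by (intro sum_mono mult_right_mono) auto
  next
    assume lo: "\<forall>x. l * (x \<bullet> x) \<le> x \<bullet> (A *v x)"
      and up: "\<forall>r x. \<psi> \<le> ereal r \<longrightarrow> x \<bullet> (A *v x) \<le> r * (x \<bullet> x)"
    have ld: "l \<le> d $ i" for i using lo ev[of i] by (metis mult.right_neutral)
    have up': "d $ i \<le> r" if "\<psi> \<le> ereal r" for i r
      using up that ev[of i] by (metis mult.right_neutral)
    have "ereal (d $ i) \<le> \<psi>" for i
    proof (cases \<psi>)
      \<comment> \<open>Every real would then be an upper bound for the entries, including one below
        \<open>d $ i\<close>.\<close>
      case MInf
      then show ?thesis using up'[of "d $ i - 1" i] by simp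
    qed (use up' in auto)
    moreover have "A \<in> pd_mats" unfolding A
      using ld l less_le_trans by (intro spectral_in_pd_mats[OF Q]) blast
    moreover have "lambda_max A \<in> range (($) d)"
      unfolding lambda_max_def A eigenvalues_spectral[OF Q] by (rule Max_in) auto
    moreover have "lambda_min A \<in> range (($) d)"
      unfolding lambda_min_def A eigenvalues_spectral[OF Q] by (rule Min_in) auto
    ultimately show "A \<in> pd_mats_between l \<psi>"
      using ld by (auto simp: pd_mats_between_def)
  qed (use True in auto)
next
  case False
  then show ?thesis unfolding pd_mats_between_def pd_mats_def by blast
qed

text \<open>An intersection of a subspace with closed half-spaces. Closedness is what places the
  event of no exit so far in the sigma-algebra of the past.\<close>

lemma closed_pd_mats_between:
  assumes l: "0 < l"
  shows "closed (pd_mats_between l \<psi> :: (real^'n^'n) set)"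
proof -
  have "pd_mats_between l \<psi> = {A :: real^'n^'n. transpose A = A} \<inter> 
    (\<Inter>x. {A. l * (x \<bullet> x) \<le> x \<bullet> (A *v x)}) \<inter>
    (\<Inter>r\<in>{r. \<psi> \<le> ereal r}. \<Inter>x. {A. x \<bullet> (A *v x) \<le> r * (x \<bullet> x)})"
    by (auto simp: pd_mats_between_iff[OF l] sym_mats_def)
  moreover have "continuous_on UNIV (\<lambda>A. transpose A :: real^'n^'n)"
    unfolding transpose_def by (intro continuous_intros)
  moreover have "closed {A :: real^'n^'n. transpose A = A}"
    by (rule closed_Collect_eq) (use calculation(2) in \<open>auto intro: continuous_on_id\<close>)
  moreover have "continuous_on UNIV (\<lambda>A :: real^'n^'n. x \<bullet> (A *v x))" for x
    unfolding matrix_vector_mult_def inner_vec_def by (simp, intro continuous_intros)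
  then have "closed {A :: real^'n^'n. c \<le> x \<bullet> (A *v x)}" "closed {A :: real^'n^'n. x \<bullet> (A *v x) \<le> c}" for c x
    by (intro closed_Collect_le continuous_on_const; blast)+
  ultimately show ?thesis
    by (simp only:) (intro closed_Int closed_INT ballI)
qed

section \<open>The contraction property of a gradient step\<close>

text \<open>The left and right rotations are independent of each other, so each of two noncommuting
  matrices can be given its own eigenbasis.\<close>

lemma norm_orthogonal_conjugate:
  fixes X Q P :: "real^'n^'n"
  assumes Q: "orthogonal_matrix Q" and P: "orthogonal_matrix P"
  shows "norm (transpose Q ** X ** P) = norm X"
proof -
  have "frob_inner (transpose Q ** X ** P) (transpose Q ** X ** P)
      = trace ((transpose P ** (transpose X ** X)) ** P)"
    using Q by (simp add: frob_inner_def matrix_transpose_mul matrix_mul_assoc[symmetric] orthogonal_matrix_cancel)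
  also have "\<dots> = trace (P ** (transpose P ** (transpose X ** X)))"
    by (rule trace_mul_sym)
  also have "\<dots> = frob_inner X X"
    using P by (simp add: frob_inner_def orthogonal_matrix_cancel)
  finally show ?thesis by (simp add: frob_inner_eq_inner norm_eq)
qed

lemma norm_matrix_squared: "(norm (A :: real^'n^'m))\<^sup>2 = (\<Sum>i\<in>UNIV. \<Sum>j\<in>UNIV. (A $ i $ j)\<^sup>2)"
  unfolding power2_norm_eq_inner by (simp add: inner_vec_def power2_eq_square)

lemma matrix_mult_diff_distrib:
  fixes A B C :: "real^'n^'n"
  shows "A ** (B - C) = A ** B - A ** C" "(B - C) ** A = B ** A - C ** A"
  by (vector matrix_matrix_mult_def sum_subtractf[symmetric] field_simps)+

lemma matrix_add_mult_distrib:
  fixes A B C :: "real^'n^'n"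
  shows "(B + C) ** A = B ** A + C ** A"
  by (vector matrix_matrix_mult_def sum.distrib[symmetric] field_simps)

lemma matrix_mult_scaleR:
  fixes A B :: "real^'n^'n"
  shows "A ** (c *\<^sub>R B) = c *\<^sub>R (A ** B)" "(c *\<^sub>R A) ** B = c *\<^sub>R (A ** B)"
  by (simp_all add: matrix_scalar_ac flip: scalar_matrix_assoc)

lemma diag_mat_mult: "(diag_mat d ** X) $ i $ j = d $ i * X $ i $ j"
  by (simp add: diag_mat_def matrix_matrix_mult_def if_distrib[of "\<lambda>c. c * _"] cong: if_cong)

lemma mult_diag_mat: "(X ** diag_mat d) $ i $ j = X $ i $ j * d $ j"
  by (simp add: diag_mat_def matrix_matrix_mult_def if_distrib[of "\<lambda>c. _ * c"] cong: if_cong)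

text \<open>With x = \<gamma> / (a b), the bound \<gamma> \<le> l^2 puts x in [0, 1], where (1 -
  x)^2 \<le> 1 - x. One power of the factor is given away here, which is why the squared error
  contracts by 1 - \<gamma> / \<psi>^2 and not by its square.\<close>

lemma contraction_factor_bounds:
  assumes "0 < l" "ereal l \<le> \<psi>" "0 < \<gamma>" "\<gamma> \<le> l\<^sup>2"
  shows "0 \<le> contraction \<gamma> \<psi>" "contraction \<gamma> \<psi> \<le> 1"
  and "l \<le> a \<Longrightarrow> ereal a \<le> \<psi> \<Longrightarrow> l \<le> b \<Longrightarrow> ereal b \<le> \<psi> \<Longrightarrow>
    (1 - \<gamma> / (a * b))\<^sup>2 \<le> contraction \<gamma> \<psi>"
proof -
  have sq: "(1 - x)\<^sup>2 \<le> 1 - x" if "0 \<le> x" "x \<le> 1" for x :: real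
    using that mult_right_mono[of x 1 x] by (simp add: power2_eq_square algebra_simps)
  have quot: "0 \<le> \<gamma> / (a * b)" "\<gamma> / (a * b) \<le> 1" if "l \<le> a" "l \<le> b" for a b
  proof -
    have "l\<^sup>2 \<le> a * b" using that assms by (simp add: power2_eq_square mult_mono)
    then show "0 \<le> \<gamma> / (a * b)" "\<gamma> / (a * b) \<le> 1"
      using that assms by (auto simp: divide_le_eq_1)
  qed
  have *: "0 \<le> contraction \<gamma> \<psi> \<and> contraction \<gamma> \<psi> \<le> 1 \<and>
    (l \<le> a \<longrightarrow> ereal a \<le> \<psi> \<longrightarrow> l \<le> b \<longrightarrow> ereal b \<le> \<psi> \<longrightarrow> (1 - \<gamma> / (a * b))\<^sup>2 \<le> contraction \<gamma> \<psi>)" for a b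
  proof (cases \<psi>)
    case (real r)
    then have r: "l \<le> r" "0 < r" using assms by auto
    have "1 - \<gamma> / (a * b) \<le> 1 - \<gamma> / r\<^sup>2" if "l \<le> a" "a \<le> r" "l \<le> b" "b \<le> r"
      using that assms r by (auto intro!: divide_left_mono mult_mono simp: power2_eq_square)
    then show ?thesis
      using quot[of r r] quot[of a b] sq[of "\<gamma> / (a * b)"] r real
      by (auto simp: power2_eq_square intro: order_trans)
  next
    case PInf
    then show ?thesis
      using quot[of a b] sq[of "\<gamma> / (a * b)"] by (auto intro: order_trans)
  qed (use assms in auto)
  from * show "0 \<le> contraction \<gamma> \<psi>" "contraction \<gamma> \<psi> \<le> 1" by auto
  from * show "l \<le> a \<Longrightarrow> ereal a \<le> \<psi> \<Longrightarrow> l \<le> b \<Longrightarrow> ereal b \<le> \<psi> \<Longrightarrow>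
    (1 - \<gamma> / (a * b))\<^sup>2 \<le> contraction \<gamma> \<psi>" by auto
qed

text \<open>In eigenbases of \<open>\<theta>\<close> and \<open>\<theta>'\<close> the map \<open>D \<mapsto> D - \<gamma> \<theta>\<^sup>-\<^sup>1 D \<theta>'\<^sup>-\<^sup>1\<close> multiplies the entry
  \<open>(i, j)\<close> by \<open>1 - \<gamma> / (d\<^sub>i e\<^sub>j)\<close>.\<close>

lemma gradient_step_contraction:
  fixes \<theta> \<theta>' :: "real^'n^'n"
  assumes "0 < l" "ereal l \<le> \<psi>" "0 < \<gamma>" "\<gamma> \<le> l\<^sup>2"
    and \<theta>: "\<theta> \<in> pd_mats_between l \<psi>" and \<theta>': "\<theta>' \<in> pd_mats_between l \<psi>"
  shows "(norm ((\<theta> - \<theta>') + \<gamma> *\<^sub>R (matrix_inv \<theta> - matrix_inv \<theta>')))\<^sup>2 \<le> contraction \<gamma> \<psi> * (norm (\<theta> - \<theta>'))\<^sup>2"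
proof -
  obtain Q d where Q: "orthogonal_matrix Q" and qd: "\<theta> = Q ** diag_mat d ** transpose Q"
    using \<theta> sym_mats_spectral by (auto simp: pd_mats_between_def pd_mats_def)
  obtain P e where P: "orthogonal_matrix P" and pe: "\<theta>' = P ** diag_mat e ** transpose P"
    using \<theta>' sym_mats_spectral by (auto simp: pd_mats_between_def pd_mats_def)
  note d = pd_mats_between_spectral[OF \<theta> Q qd] and e = pd_mats_between_spectral[OF \<theta>' P pe]
  have pos: "0 < d $ i" "0 < e $ i" for i using d(1)[of i] e(1)[of i] assms by auto
  have inv: "matrix_inv \<theta> = Q ** diag_mat (\<chi> i. 1 / d $ i) ** transpose Q"
    "matrix_inv \<theta>' = P ** diag_mat (\<chi> i. 1 / e $ i) ** transpose P"
    unfolding qd pe using pos by (simp_all add: matrix_inv_spectral Q P less_imp_neq[symmetric])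
  define W where "W = transpose Q ** P"
  \<comment> \<open>Stated for arbitrary diagonals, so that it serves the two matrices as well as
    their inverses. \<open>W\<close> is the change between the two eigenbases.\<close>
  have conj: "transpose Q ** (Q ** diag_mat a ** transpose Q - P ** diag_mat b ** transpose P) ** P
      = diag_mat a ** W - W ** diag_mat b" for a b
    using Q P by (simp add: matrix_mult_diff_distrib matrix_mul_assoc[symmetric]
        orthogonal_matrix_cancel W_def)
  define D where "D = transpose Q ** (\<theta> - \<theta>') ** P"
  define E where "E = transpose Q ** ((\<theta> - \<theta>') + \<gamma> *\<^sub>R (matrix_inv \<theta> - matrix_inv \<theta>')) ** P"
  have D: "D $ i $ j = W $ i $ j * (d $ i - e $ j)" for i j
    unfolding D_def qd pe conj by (simp add: diag_mat_mult mult_diag_mat algebra_simps)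
  have "E = D + \<gamma> *\<^sub>R (transpose Q ** (matrix_inv \<theta> - matrix_inv \<theta>') ** P)"
    unfolding E_def D_def
    by (simp add: matrix_add_ldistrib matrix_add_mult_distrib matrix_mult_scaleR)
  then have Eij: "E $ i $ j = D $ i $ j + \<gamma> * (W $ i $ j / d $ i - W $ i $ j / e $ j)" for i j
    unfolding inv conj by (simp only: vector_add_component vector_scaleR_component
        vector_minus_component diag_mat_mult mult_diag_mat) simp
  \<comment> \<open>This is 1/d - 1/e = -(d - e) / (d e), entry by entry.\<close>
  have E: "E $ i $ j = (1 - \<gamma> / (d $ i * e $ j)) * D $ i $ j" for i j
    unfolding Eij D using pos[of i] pos(2)[of j] by (simp add: field_simps)
  have "(norm E)\<^sup>2 \<le> contraction \<gamma> \<psi> * (norm D)\<^sup>2"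
    unfolding norm_matrix_squared E power_mult_distrib sum_distrib_left
    by (intro sum_mono mult_right_mono contraction_factor_bounds(3)[OF assms(1-4)] d e) auto
  then show ?thesis
    unfolding D_def E_def norm_orthogonal_conjugate[OF Q P] .
qed

section \<open>Optimality conditions\<close>

text \<open>Convexity in increment form. Divided by \<open>t\<close>, it bounds the growth of the
  nonsmooth term along a segment and takes the place of subgradients.\<close>

lemma elastic_net_convex:
  assumes "0 \<le> lam" "0 \<le> \<alpha>" "\<alpha> \<le> 1" "0 \<le> t" "t \<le> 1"
  shows "elastic_net lam \<alpha> (u + t *\<^sub>R (v - u)) \<le> elastic_net lam \<alpha> u + t * (elastic_net lam \<alpha> v - elastic_net lam \<alpha> u)"
proof -
  have abs: "\<bar>x + t * (y - x)\<bar> \<le> \<bar>x\<bar> + t * (\<bar>y\<bar> - \<bar>x\<bar>)" for x y :: real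
  proof -
    have "x + t * (y - x) = (1 - t) * x + t * y" by (simp add: algebra_simps)
    then have "\<bar>x + t * (y - x)\<bar> \<le> \<bar>(1 - t) * x\<bar> + \<bar>t * y\<bar>" by simp
    also have "\<dots> = \<bar>x\<bar> + t * (\<bar>y\<bar> - \<bar>x\<bar>)"
      unfolding abs_mult using assms by (simp add: algebra_simps)
    finally show ?thesis .
  qed
  have sq: "(x + t * (y - x))\<^sup>2 \<le> x\<^sup>2 + t * (y\<^sup>2 - x\<^sup>2)" for x y :: real
  proof -
    have "x\<^sup>2 + t * (y\<^sup>2 - x\<^sup>2) - (x + t * (y - x))\<^sup>2 = t * (1 - t) * (x - y)\<^sup>2"
      by (simp add: power2_eq_square algebra_simps)
    moreover have "0 \<le> t * (1 - t) * (x - y)\<^sup>2" using assms by simp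
    ultimately show ?thesis by linarith
  qed
  have "\<alpha> * lam * \<bar>x + t * (y - x)\<bar> + (1 - \<alpha>) / 2 * lam * (x + t * (y - x))\<^sup>2
    \<le> \<alpha> * lam * (\<bar>x\<bar> + t * (\<bar>y\<bar> - \<bar>x\<bar>)) + (1 - \<alpha>) / 2 * lam * (x\<^sup>2 + t * (y\<^sup>2 - x\<^sup>2))" for x y
    using assms by (intro add_mono mult_left_mono abs sq) auto
  also have "\<dots> x y = (\<alpha> * lam * \<bar>x\<bar> + (1 - \<alpha>) / 2 * lam * x\<^sup>2) + t * ((\<alpha> * lam * \<bar>y\<bar> + (1 - \<alpha>) / 2 * lam * y\<^sup>2) - (\<alpha> * lam * \<bar>x\<bar> + (1 - \<alpha>) / 2 * lam * x\<^sup>2))" for x y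
    by (simp add: algebra_simps)
  finally show ?thesis
    unfolding elastic_net_def sum_distrib_left sum_subtractf[symmetric] sum.distrib[symmetric]
    by (intro sum_mono) simp
qed

lemma elastic_net_nonneg: "0 \<le> lam \<Longrightarrow> 0 \<le> \<alpha> \<Longrightarrow> \<alpha> \<le> 1 \<Longrightarrow> 0 \<le> elastic_net lam \<alpha> u"
  unfolding elastic_net_def by (intro sum_nonneg add_nonneg_nonneg mult_nonneg_nonneg) auto

lemma subspace_sym_mats: "subspace (sym_mats :: (real^'n^'n) set)"
  by (auto simp: subspace_def sym_mats_def transpose_def vec_eq_iff)

text \<open>\<open>arg_min_on\<close> is a choice operator, so \<open>prox\<close> is a minimiser
  only once existence is known. As the penalty is nonnegative, every matrix doing at least as well
  as 0 lies in a ball around \<open>w\<close>, and compactness applies.\<close>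

lemma prox_is_arg_min:
  fixes w :: "real^'n^'n"
  assumes "0 \<le> lam" "0 \<le> \<alpha>" "\<alpha> \<le> 1" "0 < \<gamma>"
  shows "is_arg_min (\<lambda>u. elastic_net lam \<alpha> u + 1 / (2 * \<gamma>) * (norm (u - w))\<^sup>2) (\<lambda>u. u \<in> sym_mats) (prox \<gamma> lam \<alpha> w)"
proof -
  define F :: "real^'n^'n \<Rightarrow> real" where "F = (\<lambda>u. elastic_net lam \<alpha> u + 1 / (2 * \<gamma>) * (norm (u - w))\<^sup>2)"
  have F_ge: "(norm (u - w))\<^sup>2 \<le> 2 * \<gamma> * F u" for u
    using elastic_net_nonneg[of lam \<alpha> u] assms by (simp add: F_def field_simps)
  define K where "K = cball w (sqrt (2 * \<gamma> * F 0)) \<inter> sym_mats"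
  have "compact K"
    unfolding K_def by (intro compact_Int_closed compact_cball closed_subspace subspace_sym_mats)
  moreover have in_K: "u \<in> K" if "u \<in> sym_mats" "F u \<le> F 0" for u
  proof -
    have "2 * \<gamma> * F u \<le> 2 * \<gamma> * F 0" using that assms by simp
    then have "(norm (u - w))\<^sup>2 \<le> 2 * \<gamma> * F 0" using F_ge[of u] by linarith
    then show ?thesis using that by (simp add: K_def dist_norm norm_minus_commute real_le_rsqrt)
  qed
  moreover have "0 \<in> K" using in_K subspace_0[OF subspace_sym_mats] by auto
  moreover have "continuous_on K F"
    unfolding F_def elastic_net_def by (intro continuous_intros)
  ultimately obtain u where u: "u \<in> K" "\<And>v. v \<in> K \<Longrightarrow> F u \<le> F v"
    using continuous_attains_inf[of K F] by blast
  have "F u \<le> F v" if "v \<in> sym_mats" for v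
    using u in_K[OF that] \<open>0 \<in> K\<close> by (cases "F v \<le> F 0") force+
  then have "is_arg_min F (\<lambda>u. u \<in> sym_mats) u"
    using u(1) by (auto simp: is_arg_min_def K_def not_less)
  then have "is_arg_min F (\<lambda>u. u \<in> sym_mats) (arg_min_on F sym_mats)"
    unfolding arg_min_on_def arg_min_def by (rule someI)
  then show ?thesis by (simp add: F_def prox_def frob_norm_eq_norm)
qed

text \<open>First-order condition for a smooth part plus a convex one: \<open>H\<close> is the
  increment of the smooth part, and \<open>t * c\<close> bounds that of the convex part, so only
  \<open>H\<close> is differentiated.\<close>

lemma right_derivative_nonneg:
  fixes H :: "real \<Rightarrow> real"
  assumes "(H has_real_derivative h) (at 0)" "H 0 = 0"
    and "\<forall>\<^sub>F t in at_right 0. 0 \<le> H t + t * c"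
  shows "0 \<le> h + c"
proof (rule tendsto_lowerbound)
  have "((\<lambda>t. H t / t) \<longlongrightarrow> h) (at 0)"
    using assms(1,2) by (simp add: has_field_derivative_iff)
  then have "((\<lambda>t. H t / t) \<longlongrightarrow> h) (at_right 0)"
    by (rule filterlim_mono) (auto simp: at_le)
  then show "((\<lambda>t. H t / t + c) \<longlongrightarrow> h + c) (at_right 0)"
    by (intro tendsto_intros)
  have "\<forall>\<^sub>F t in at_right 0. (0::real) < t" by (simp add: eventually_at_right_less)
  with assms(3) show "\<forall>\<^sub>F t in at_right 0. 0 \<le> H t / t + c"
    by eventually_elim (simp add: field_simps)
qed simp

text \<open>Says that \<open>(w - u) /\<^sub>R \<gamma>\<close> is a subgradient of the penalty at
  the proximal point \<open>u\<close>, tested against symmetric matrices.\<close>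

lemma prox_variational:
  fixes w v :: "real^'n^'n"
  assumes "0 \<le> lam" "0 \<le> \<alpha>" "\<alpha> \<le> 1" "0 < \<gamma>" "v \<in> sym_mats"
  defines "u \<equiv> prox \<gamma> lam \<alpha> w"
  shows "u \<in> sym_mats" "(w - u) \<bullet> (v - u) \<le> \<gamma> * (elastic_net lam \<alpha> v - elastic_net lam \<alpha> u)"
proof -
  let ?g = "elastic_net lam \<alpha>"
  have u: "u \<in> sym_mats"
    and mn: "\<And>y. y \<in> sym_mats \<Longrightarrow> ?g u + 1 / (2 * \<gamma>) * (norm (u - w))\<^sup>2 \<le> ?g y + 1 / (2 * \<gamma>) * (norm (y - w))\<^sup>2"
    using prox_is_arg_min[OF assms(1-4), of w] by (auto simp: is_arg_min_def u_def not_less)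
  show "u \<in> sym_mats" by (fact u)
  \<comment> \<open>The change of the quadratic penalty along the segment from \<open>u\<close>
    towards \<open>v\<close>.\<close>
  define H where "H t = 1 / (2 * \<gamma>) * (2 * t * ((u - w) \<bullet> (v - u)) + t\<^sup>2 * (norm (v - u))\<^sup>2)" for t
  have "0 \<le> 1 / \<gamma> * ((u - w) \<bullet> (v - u)) + (?g v - ?g u)"
  proof (rule right_derivative_nonneg)
    show "(H has_real_derivative 1 / \<gamma> * ((u - w) \<bullet> (v - u))) (at 0)"
      unfolding H_def using assms(4) by (auto intro!: derivative_eq_intros)
    show "H 0 = 0" by (simp add: H_def)
    have "0 \<le> H t + t * (?g v - ?g u)" if t: "0 < t" "t < 1" for t
    proof -
      let ?y = "u + t *\<^sub>R (v - u)"
      have "?y \<in> sym_mats"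
        using u assms(5) by (intro subspace_add subspace_scale subspace_diff subspace_sym_mats)
      note mn[OF this]
      moreover have "?y - w = (u - w) + t *\<^sub>R (v - u)" by simp
      then have "(norm (?y - w))\<^sup>2 = (norm (u - w))\<^sup>2 + (2 * t * ((u - w) \<bullet> (v - u)) + t\<^sup>2 * (norm (v - u))\<^sup>2)"
        unfolding power2_norm_eq_inner
        by (simp only: inner_add_left inner_add_right inner_scaleR_left inner_scaleR_right inner_commute[of "v - u" "u - w"])
          (simp add: power2_eq_square algebra_simps)
      then have "1 / (2 * \<gamma>) * (norm (?y - w))\<^sup>2 = 1 / (2 * \<gamma>) * (norm (u - w))\<^sup>2 + H t"
        by (simp only: H_def distrib_left)
      ultimately show ?thesis
        using elastic_net_convex[of lam \<alpha> t u v] assms t by linarith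
    qed
    then show "\<forall>\<^sub>F t in at_right 0. 0 \<le> H t + t * (?g v - ?g u)"
      by (auto simp: eventually_at_right_field intro: exI[of _ 1])
  qed
  moreover have "(w - u) \<bullet> (v - u) = - ((u - w) \<bullet> (v - u))" by (simp add: inner_diff_left)
  ultimately show "(w - u) \<bullet> (v - u) \<le> \<gamma> * (?g v - ?g u)"
    using assms by (simp add: field_simps)
qed

section \<open>Differentiating the log-determinant, and optimality of the minimiser\<close>

text \<open>Splitting the diagonal as a product of square roots gives the factor P = diag(sqrt d)
  Q^T and its inverse R. Congruence by them reduces perturbations of \<open>A\<close> to
  perturbations of the identity.\<close>

lemma pd_mats_factor:
  fixes A :: "real^'n^'n"
  assumes A: "A \<in> pd_mats"
  obtains P R :: "real^'n^'n" where "A = transpose P ** P" "P ** R = mat 1" "R ** P = mat 1"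
    "matrix_inv A = R ** transpose R"
proof -
  obtain Q d where Q: "orthogonal_matrix Q" and qd: "A = Q ** diag_mat d ** transpose Q"
    using assms sym_mats_spectral by (auto simp: pd_mats_def)
  note d = pd_mats_spectral_pos[OF A Q qd]
  have inv: "matrix_inv A = Q ** diag_mat (\<chi> i. 1 / d $ i) ** transpose Q"
    unfolding qd using d by (simp add: matrix_inv_spectral Q less_imp_neq[symmetric])
  define s where "s = (\<chi> i. sqrt (d $ i))"
  define r where "r = (\<chi> i. 1 / sqrt (d $ i))"
  have [simp]: "(\<chi> i. s $ i * s $ i) = d" "(\<chi> i. s $ i * r $ i) = (\<chi> i. 1)"
    "(\<chi> i. r $ i * r $ i) = (\<chi> i. 1 / d $ i)"
    using d by (auto simp: s_def r_def vec_eq_iff less_imp_le less_imp_neq[symmetric])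
  define P where "P = diag_mat s ** transpose Q"
  define R where "R = Q ** diag_mat r"
  have "A = transpose P ** P"
    unfolding qd P_def
    by (simp add: matrix_transpose_mul transpose_diag_mat matrix_mul_assoc)
      (simp add: matrix_mul_assoc[symmetric] diag_mat_mult_diag_mat)
  moreover have PR: "P ** R = mat 1"
    unfolding P_def R_def using Q
    by (simp add: matrix_mul_assoc[symmetric] orthogonal_matrix_cancel)
      (simp add: diag_mat_mult_diag_mat diag_mat_one)
  moreover have "R ** P = mat 1" using PR matrix_left_right_inverse by blast
  moreover have "matrix_inv A = R ** transpose R"
    unfolding inv R_def
    by (simp add: matrix_transpose_mul transpose_diag_mat matrix_mul_assoc)
      (simp add: matrix_mul_assoc[symmetric] diag_mat_mult_diag_mat)
  ultimately show thesis using that by blast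
qed

lemma pd_mats_congruence:
  fixes B P :: "real^'n^'n"
  assumes B: "B \<in> pd_mats" and "R ** P = mat 1"
  shows "transpose P ** B ** P \<in> pd_mats"
proof -
  have "transpose (transpose P ** B ** P) = transpose P ** B ** P"
    using B by (simp add: pd_mats_def sym_mats_def matrix_transpose_mul matrix_mul_assoc)
  moreover have "0 < x \<bullet> ((transpose P ** B ** P) *v x)" if "x \<noteq> 0" for x
  proof -
    have "R *v (P *v x) = x" using assms by (simp add: matrix_vector_mul_assoc)
    then have "P *v x \<noteq> 0" using that by auto
    moreover have "x \<bullet> ((transpose P ** B ** P) *v x) = (P *v x) \<bullet> (B *v (P *v x))"
      by (metis dot_lmul_matrix matrix_vector_mul_assoc transpose_matrix_vector transpose_transpose)
    ultimately show ?thesis using B by (simp add: pd_mats_def)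
  qed
  ultimately show ?thesis by (simp add: pd_mats_def sym_mats_def)
qed

text \<open>With \<open>\<theta> = P\<^sup>T P\<close>, the perturbation \<open>\<theta> + t E\<close> is congruent to \<open>I + t M\<close>, whose determinant
  is the product of the \<open>1 + t m\<^sub>i\<close> over the eigenvalues \<open>m\<^sub>i\<close> of \<open>M\<close>.\<close>

lemma neg_loglik_directional_derivative:
  fixes \<theta> E :: "real^'n^'n"
  assumes \<theta>: "\<theta> \<in> pd_mats" and E: "E \<in> sym_mats"
  shows "((\<lambda>t. neg_loglik S (\<theta> + t *\<^sub>R E)) has_real_derivative (S - matrix_inv \<theta>) \<bullet> E) (at 0)"
    and "\<forall>\<^sub>F t in at 0. \<theta> + t *\<^sub>R E \<in> pd_mats"
proof -
  obtain P R :: "real^'n^'n" where P: "\<theta> = transpose P ** P" "P ** R = mat 1" "R ** P = mat 1"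
    and inv: "matrix_inv \<theta> = R ** transpose R"
    by (rule pd_mats_factor[OF \<theta>])
  define M where "M = transpose R ** E ** R"
  have "transpose M = M"
    using E by (simp add: M_def sym_mats_def matrix_transpose_mul matrix_mul_assoc)
  then obtain Q m where Q: "orthogonal_matrix Q" and M: "M = Q ** diag_mat m ** transpose Q"
    by (rule symmetric_matrix_spectral)
  have PR': "transpose P ** transpose R = mat 1"
    by (simp add: matrix_transpose_mul[symmetric] P)
  have "transpose P ** M ** P = (transpose P ** transpose R) ** E ** (R ** P)"
    by (simp add: M_def matrix_mul_assoc)
  then have PMP: "transpose P ** M ** P = E" by (simp add: PR' P)
  define D where "D t = Q ** diag_mat (\<chi> i. 1 + t * m $ i) ** transpose Q" for t
  have "diag_mat (\<chi> i. 1 + t * m $ i) = mat 1 + t *\<^sub>R diag_mat m" for t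
    by (simp add: diag_mat_def mat_def vec_eq_iff)
  then have D: "D t = mat 1 + t *\<^sub>R M" for t
    using Q by (simp add: D_def M matrix_add_ldistrib matrix_add_mult_distrib matrix_mult_scaleR orthogonal_matrix_cancel)
  have eq: "\<theta> + t *\<^sub>R E = transpose P ** D t ** P" for t
    by (simp add: D P(1) PMP[symmetric] matrix_add_ldistrib matrix_add_mult_distrib matrix_mult_scaleR)
  \<comment> \<open>With finitely many eigenvalues, one neighbourhood of 0 works for all factors; it
    yields both positive definiteness and the splitting of the logarithm.\<close>
  have ev: "\<forall>\<^sub>F t in nhds 0. \<forall>i. 0 < 1 + t * m $ i"
  proof (rule eventually_all_finite)
    fix i
    have "((\<lambda>t. 1 + t * m $ i) \<longlongrightarrow> 1 + 0 * m $ i) (nhds 0)" by (intro tendsto_intros filterlim_ident)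
    then show "\<forall>\<^sub>F t in nhds 0. 0 < 1 + t * m $ i" by (rule order_tendstoD) simp
  qed
  have pd: "D t \<in> pd_mats" if "\<forall>i. 0 < 1 + t * m $ i" for t
    unfolding D_def using that by (intro spectral_in_pd_mats[OF Q]) simp
  have "\<forall>\<^sub>F t in nhds 0. \<theta> + t *\<^sub>R E \<in> pd_mats"
    using ev unfolding eq by eventually_elim (intro pd_mats_congruence[OF _ P(3)] pd)
  then show "\<forall>\<^sub>F t in at 0. \<theta> + t *\<^sub>R E \<in> pd_mats"
    by (simp add: eventually_at_filter eventually_mono)
  have det\<theta>: "0 < det \<theta>" using matrix_inv_pd[OF \<theta>] by simp
  have QQ: "det Q * det (transpose Q) = 1"
    using orthogonal_matrix_cancel(2)[OF Q] by (metis det_I det_mul)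
  have det: "det (\<theta> + t *\<^sub>R E) = det \<theta> * (\<Prod>i\<in>UNIV. 1 + t * m $ i)" for t
    unfolding eq unfolding P(1) D_def using QQ by (simp add: det_mul det_diag_mat)
  have "neg_loglik S (\<theta> + t *\<^sub>R E)
      = - ln (det \<theta>) - (\<Sum>i\<in>UNIV. ln (1 + t * m $ i)) + trace (\<theta> ** S) + t * trace (E ** S)"
    if t: "\<forall>i. 0 < 1 + t * m $ i" for t
  proof -
    have "ln (det (\<theta> + t *\<^sub>R E)) = ln (det \<theta>) + ln (\<Prod>i\<in>UNIV. 1 + t * m $ i)"
      unfolding det using det\<theta> t by (intro ln_mult_pos prod_pos) auto
    also have "ln (\<Prod>i\<in>UNIV. 1 + t * m $ i) = (\<Sum>i\<in>UNIV. ln (1 + t * m $ i))"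
      using t by (intro ln_prod) (auto simp: less_imp_neq[symmetric])
    moreover have "trace ((\<theta> + t *\<^sub>R E) ** S) = trace (\<theta> ** S) + t * trace (E ** S)"
      unfolding matrix_add_mult_distrib matrix_mult_scaleR trace_add
      by (simp add: trace_def sum_distrib_left)
    ultimately show ?thesis by (simp add: neg_loglik_def)
  qed
  then have lndet: "\<forall>\<^sub>F t in nhds 0. neg_loglik S (\<theta> + t *\<^sub>R E)
      = - ln (det \<theta>) - (\<Sum>i\<in>UNIV. ln (1 + t * m $ i)) + trace (\<theta> ** S) + t * trace (E ** S)"
    using ev by (rule eventually_mono[rotated])
  \<comment> \<open>Cyclicity of the trace identifies this with the sum of the eigenvalues of
    \<open>M\<close>, which is the derivative at 0 of the sum of the ln(1 + t m_i).\<close>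
  have "trace (matrix_inv \<theta> ** E) = trace M"
    unfolding inv M_def trace_mul_sym[of "transpose R ** E"] by (simp add: matrix_mul_assoc)
  also have "\<dots> = trace (diag_mat m)"
    unfolding M by (subst trace_mul_sym) (simp add: Q orthogonal_matrix_cancel)
  finally have tr: "trace (matrix_inv \<theta> ** E) = (\<Sum>i\<in>UNIV. m $ i)"
    by (simp add: trace_def diag_mat_def)
  have inner: "X \<bullet> E = trace (E ** X)" for X
  proof -
    have "X \<bullet> E = frob_inner E X" by (simp add: frob_inner_eq_inner inner_commute)
    then show ?thesis using E by (simp add: frob_inner_def sym_mats_def)
  qed
  have val: "(S - matrix_inv \<theta>) \<bullet> E = - (\<Sum>i\<in>UNIV. m $ i) + trace (E ** S)"
    unfolding inner_diff_left unfolding inner trace_mul_sym[of E "matrix_inv \<theta>"] tr by simp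
  have "((\<lambda>t. - ln (det \<theta>) - (\<Sum>i\<in>UNIV. ln (1 + t * m $ i)) + trace (\<theta> ** S) + t * trace (E ** S))
      has_real_derivative (S - matrix_inv \<theta>) \<bullet> E) (at 0)"
    unfolding val by (auto intro!: derivative_eq_intros)
  then show "((\<lambda>t. neg_loglik S (\<theta> + t *\<^sub>R E)) has_real_derivative (S - matrix_inv \<theta>) \<bullet> E) (at 0)"
    using DERIV_cong_ev[OF refl lndet refl] by simp
qed

text \<open>A short step from \<theta> towards any symmetric \<open>v\<close> stays positive
  definite. Allowing all symmetric \<open>v\<close> matters: the proximal point inserted later may
  fail to be positive definite.\<close>

lemma objective_minimiser_variational:
  fixes \<theta> v :: "real^'n^'n"
  assumes "0 \<le> lam" "0 \<le> \<alpha>" "\<alpha> \<le> 1"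
    and mn: "is_arg_min (objective S lam \<alpha>) (\<lambda>\<theta>. \<theta> \<in> pd_mats) \<theta>" and v: "v \<in> sym_mats"
  shows "0 \<le> (S - matrix_inv \<theta>) \<bullet> (v - \<theta>) + (elastic_net lam \<alpha> v - elastic_net lam \<alpha> \<theta>)"
proof -
  let ?g = "elastic_net lam \<alpha>"
  have \<theta>: "\<theta> \<in> pd_mats" using mn by (simp add: is_arg_min_def)
  then have E: "v - \<theta> \<in> sym_mats"
    using v by (intro subspace_diff subspace_sym_mats) (auto simp: pd_mats_def)
  note der = neg_loglik_directional_derivative[OF \<theta> E]
  define H where "H t = neg_loglik S (\<theta> + t *\<^sub>R (v - \<theta>)) - neg_loglik S \<theta>" for t
  show ?thesis
  proof (rule right_derivative_nonneg)
    show "(H has_real_derivative (S - matrix_inv \<theta>) \<bullet> (v - \<theta>)) (at 0)"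
      unfolding H_def using DERIV_diff[OF der(1)[of S] DERIV_const] by simp
    show "H 0 = 0" by (simp add: H_def)
    have "\<forall>\<^sub>F t in at_right 0. \<theta> + t *\<^sub>R (v - \<theta>) \<in> pd_mats"
      using der(2) by (rule filter_leD[rotated]) (simp add: at_le)
    moreover have "\<forall>\<^sub>F t in at_right 0. 0 < t \<and> t < (1::real)"
      by (auto simp: eventually_at_right_field intro: exI[of _ 1])
    ultimately show "\<forall>\<^sub>F t in at_right 0. 0 \<le> H t + t * (?g v - ?g \<theta>)"
    proof eventually_elim
      case (elim t)
      have "objective S lam \<alpha> \<theta> \<le> objective S lam \<alpha> (\<theta> + t *\<^sub>R (v - \<theta>))"
        using mn elim by (auto simp: is_arg_min_def not_less)
      then show ?case
        using elastic_net_convex[of lam \<alpha> t \<theta> v] assms elim by (simp add: objective_def H_def)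
    qed
  qed
qed

text \<open>Each of the two variational inequalities is tested at the other point; in the sum the
  penalties cancel, and Cauchy-Schwarz finishes. The inequality for the minimiser stands in for its
  fixed-point equation.\<close>

lemma prox_step_nonexpansive:
  fixes w \<theta>' :: "real^'n^'n"
  assumes "0 \<le> lam" "0 \<le> \<alpha>" "\<alpha> \<le> 1" "0 < \<gamma>"
    and mn: "is_arg_min (objective S lam \<alpha>) (\<lambda>\<theta>. \<theta> \<in> pd_mats) \<theta>'"
  shows "norm (prox \<gamma> lam \<alpha> w - \<theta>') \<le> norm (w - (\<theta>' - \<gamma> *\<^sub>R (S - matrix_inv \<theta>')))"
proof -
  define u where "u = prox \<gamma> lam \<alpha> w"
  define w' where "w' = \<theta>' - \<gamma> *\<^sub>R (S - matrix_inv \<theta>')"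
  have \<theta>': "\<theta>' \<in> sym_mats" using mn by (simp add: is_arg_min_def pd_mats_def)
  have u: "u \<in> sym_mats" "(w - u) \<bullet> (\<theta>' - u) \<le> \<gamma> * (elastic_net lam \<alpha> \<theta>' - elastic_net lam \<alpha> u)"
    using prox_variational[OF assms(1-4) \<theta>'] by (auto simp: u_def)
  have "0 \<le> \<gamma> * ((S - matrix_inv \<theta>') \<bullet> (u - \<theta>') + (elastic_net lam \<alpha> u - elastic_net lam \<alpha> \<theta>'))"
    using objective_minimiser_variational[OF assms(1-3) mn u(1)] assms by simp
  then have "(w - u) \<bullet> (\<theta>' - u) \<le> (\<theta>' - w') \<bullet> (u - \<theta>')"
    using u(2) by (simp add: w'_def algebra_simps)
  then have "(u - \<theta>') \<bullet> (u - \<theta>') \<le> (w - w') \<bullet> (u - \<theta>')"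
    by (simp add: inner_diff_left inner_diff_right inner_commute)
  also have "\<dots> \<le> norm (w - w') * norm (u - \<theta>')" by (rule norm_cauchy_schwarz)
  finally have "norm (u - \<theta>') * norm (u - \<theta>') \<le> norm (w - w') * norm (u - \<theta>')"
    by (simp add: power2_norm_eq_inner[symmetric] power2_eq_square)
  then have "norm (u - \<theta>') \<le> norm (w - w')"
    by (cases "norm (u - \<theta>') = 0") (auto simp: mult_le_cancel_right)
  then show ?thesis by (simp add: u_def w'_def)
qed

section \<open>Moments of the Gaussian law\<close>

lemma nn_integral_lborel_reflect:
  fixes t :: "'a::euclidean_space"
  assumes [measurable]: "f \<in> borel_measurable borel"
  shows "(\<integral>\<^sup>+x. f (t - x) \<partial>lborel) = (\<integral>\<^sup>+x. f x \<partial>lborel)"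
  by (subst (2) lborel_affine[of "-1" t]) (simp_all add: nn_integral_density nn_integral_distr)

lemma nn_integral_lborel_translate:
  fixes t :: "'a::euclidean_space"
  assumes [measurable]: "f \<in> borel_measurable borel"
  shows "(\<integral>\<^sup>+x. f (x + t) \<partial>lborel) = (\<integral>\<^sup>+x. f x \<partial>lborel)"
  by (subst (2) lborel_affine[of 1 t]) (simp_all add: nn_integral_density nn_integral_distr add.commute)

lemma measurable_matrix_vector_mult [measurable]:
  fixes A :: "real^'n^'m"
  shows "(*v) A \<in> borel_measurable borel"
  by (intro borel_measurable_continuous_onI linear_continuous_on) simp

text \<open>Uniqueness of Haar measure: integrating \<open>1\<^sub>E(x) 1\<^sub>B(Q y - x)\<close> over \<open>x\<close> and \<open>y\<close> in both orders,
  for the unit ball \<open>B\<close>, which \<open>Q\<close> preserves.\<close>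

lemma lborel_distr_orthogonal:
  fixes Q :: "real^'n^'n"
  assumes Q: "orthogonal_matrix Q"
  shows "distr lborel borel ((*v) Q) = lborel"
proof (rule measure_eqI)
  show "sets (distr lborel borel ((*v) Q)) = sets lborel" by simp
  fix E :: "(real^'n) set" assume "E \<in> sets (distr lborel borel ((*v) Q))"
  then have E [measurable]: "E \<in> sets borel" by simp
  define B :: "(real^'n) set" where "B = ball 0 1"
  have B [measurable]: "B \<in> sets borel" by (simp add: B_def)
  \<comment> \<open>Positive and finite mass is what permits cancelling the ball at the end.\<close>
  have Bfin: "emeasure lborel B \<noteq> 0" "emeasure lborel B \<noteq> \<infinity>"
    using emeasure_bounded_finite[of B] content_ball_pos[of 1 "0 :: real^'n"]
    by (auto simp: B_def measure_def)
  have QB: "Q *v y \<in> B \<longleftrightarrow> y \<in> B" for y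
    by (simp add: B_def norm_orthogonal_matrix_mult_vec[OF Q])
  have shift: "(\<integral>\<^sup>+y. f (Q *v y - x) \<partial>lborel) = (\<integral>\<^sup>+y. f (Q *v y) \<partial>lborel)"
    if [measurable]: "f \<in> borel_measurable borel" for f :: "real^'n \<Rightarrow> ennreal" and x
  proof -
    have "(\<integral>\<^sup>+y. f (Q *v y - x) \<partial>lborel) = (\<integral>\<^sup>+y. f (Q *v (y + - (transpose Q *v x))) \<partial>lborel)"
      by (simp add: matrix_vector_mult_diff_distrib orthogonal_matrix_cancel[OF Q])
    also have "\<dots> = (\<integral>\<^sup>+y. f (Q *v y) \<partial>lborel)"
      by (rule nn_integral_lborel_translate) measurable
    finally show ?thesis .
  qed
  have "emeasure lborel E * emeasure lborel B = (\<integral>\<^sup>+x. indicator E x * (\<integral>\<^sup>+y. indicator B (Q *v y) \<partial>lborel) \<partial>lborel)"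
    by (simp add: QB nn_integral_multc indicator_def of_bool_def[symmetric] flip: nn_integral_indicator)
  also have "\<dots> = (\<integral>\<^sup>+x. \<integral>\<^sup>+y. indicator E x * indicator B (Q *v y - x) \<partial>lborel \<partial>lborel)"
    by (simp add: nn_integral_cmult shift)
  also have "\<dots> = (\<integral>\<^sup>+y. \<integral>\<^sup>+x. indicator E x * indicator B (Q *v y - x) \<partial>lborel \<partial>lborel)"
    by (rule lborel_pair.Fubini'[symmetric]) measurable
  \<comment> \<open>For fixed \<open>y\<close> the reflection of \<open>x\<close> to
    \<open>Q *v y - x\<close> preserves Lebesgue measure; it moves the dependence on
    \<open>Q\<close> from \<open>B\<close> to \<open>E\<close>.\<close>
  also have "\<dots> = (\<integral>\<^sup>+y. \<integral>\<^sup>+x. indicator E (Q *v y - x) * indicator B (Q *v y - (Q *v y - x)) \<partial>lborel \<partial>lborel)"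
    by (intro nn_integral_cong nn_integral_lborel_reflect[symmetric]) measurable
  also have "\<dots> = (\<integral>\<^sup>+y. \<integral>\<^sup>+x. indicator E (Q *v y - x) * indicator B x \<partial>lborel \<partial>lborel)" by simp
  also have "\<dots> = (\<integral>\<^sup>+x. \<integral>\<^sup>+y. indicator E (Q *v y - x) * indicator B x \<partial>lborel \<partial>lborel)"
    by (rule lborel_pair.Fubini') measurable
  also have "\<dots> = (\<integral>\<^sup>+x. (\<integral>\<^sup>+y. indicator E (Q *v y) \<partial>lborel) * indicator B x \<partial>lborel)"
    by (simp add: nn_integral_multc shift)
  also have "\<dots> = emeasure (distr lborel borel ((*v) Q)) E * emeasure lborel B"
    by (simp add: nn_integral_cmult nn_integral_distr flip: nn_integral_indicator)
  finally show "emeasure (distr lborel borel ((*v) Q)) E = emeasure lborel E"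
    using Bfin by (simp add: mult.commute[of _ "emeasure lborel B"] ennreal_mult_cancel_left)
qed

lemma nn_integral_lborel_vec_prod:
  fixes h :: "'n::finite \<Rightarrow> real \<Rightarrow> ennreal"
  assumes [measurable]: "\<And>i. h i \<in> borel_measurable borel"
  shows "(\<integral>\<^sup>+y. (\<Prod>i\<in>UNIV. h i (y $ i)) \<partial>(lborel :: (real^'n) measure)) = (\<Prod>i\<in>UNIV. \<integral>\<^sup>+t. h i t \<partial>lborel)"
proof -
  define ix :: "real^'n \<Rightarrow> 'n" where "ix b = (THE i. b = axis i 1)" for b
  have ix: "ix (axis i 1) = i" for i by (auto simp: ix_def axis_eq_axis)
  have inj: "inj_on (\<lambda>i. axis i (1::real)) (UNIV :: 'n set)" by (auto simp: inj_on_def axis_eq_axis)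
  have Basis: "(Basis :: (real^'n) set) = (\<lambda>i. axis i 1) ` UNIV" by (auto simp: Basis_vec_def)
  have "(\<integral>\<^sup>+y. (\<Prod>b\<in>Basis. h (ix b) (y \<bullet> b)) \<partial>(lborel :: (real^'n) measure))
      = (\<Prod>b\<in>(Basis :: (real^'n) set). \<integral>\<^sup>+t. h (ix b) t \<partial>lborel)"
    by (rule nn_integral_lborel_prod) auto
  then show ?thesis
    unfolding Basis prod.reindex[OF inj] by (simp add: ix inner_axis o_def)
qed

section \<open>Centred normal laws with independent coordinates\<close>

lemma sqrt_prod: "sqrt (\<Prod>i\<in>A. f i) = (\<Prod>i\<in>A. sqrt (f i))"
  by (induction A rule: infinite_finite_induct) (auto simp: real_sqrt_mult)

text \<open>The entries of \<open>d\<close> are precisions, not variances: they will be the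
  eigenvalues of \<theta>, whose inverse is the covariance.\<close>

definition normal_vec :: "real^'n \<Rightarrow> (real^'n) measure" where
  "normal_vec d = density lborel (\<lambda>y. ennreal (\<Prod>i\<in>UNIV. normal_density 0 (1 / sqrt (d $ i)) (y $ i)))"

lemma sets_normal_vec [measurable_cong, simp]: "sets (normal_vec d) = sets borel"
  by (simp add: normal_vec_def)

lemma space_normal_vec [simp]: "space (normal_vec d) = UNIV"
  by (simp add: normal_vec_def)

text \<open>All even mixed moments at once, since the density factorises. Each factor is (2k - 1)!!
  / d^k; \<open>k = 0\<close> gives total mass one, and total weight one or two gives the moments
  used below.\<close>

lemma nn_integral_normal_vec_moment:
  fixes d :: "real^'n"
  assumes d: "\<And>i. 0 < d $ i"
  shows "(\<integral>\<^sup>+y. ennreal (\<Prod>i\<in>UNIV. (y $ i) ^ (2 * k i)) \<partial>normal_vec d)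
    = ennreal (\<Prod>i\<in>UNIV. fact (2 * k i) / ((2 * d $ i) ^ k i * fact (k i)))"
proof -
  let ?f = "\<lambda>i t. normal_density 0 (1 / sqrt (d $ i)) t * t ^ (2 * k i)"
  have mom: "(\<integral>\<^sup>+t. ennreal (?f i t) \<partial>lborel) = ennreal (fact (2 * k i) / ((2 * d $ i) ^ k i * fact (k i)))" for i
  proof -
    have "has_bochner_integral lborel (?f i) (fact (2 * k i) / ((2 * d $ i) ^ k i * fact (k i)))"
      using normal_moment_even[of "1 / sqrt (d $ i)" 0 "k i"] d[of i]
      by (simp add: power_divide less_imp_le)
    then show ?thesis
      by (subst nn_integral_eq_integral)
        (auto simp: has_bochner_integral_iff zero_le_even_power intro!: AE_I2 mult_nonneg_nonneg)
  qed
  have nn: "0 \<le> ?f i t" for i t by (simp add: zero_le_even_power)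
  have "(\<integral>\<^sup>+y. ennreal (\<Prod>i\<in>UNIV. (y $ i) ^ (2 * k i)) \<partial>normal_vec d)
      = (\<integral>\<^sup>+y. (\<Prod>i\<in>UNIV. ennreal (?f i (y $ i))) \<partial>lborel)"
    unfolding normal_vec_def
    by (subst nn_integral_density)
      (auto simp: prod_ennreal nn prod.distrib ennreal_mult'[symmetric] prod_nonneg)
  also have "\<dots> = (\<Prod>i\<in>UNIV. \<integral>\<^sup>+t. ennreal (?f i t) \<partial>lborel)"
    by (rule nn_integral_lborel_vec_prod) measurable
  also have "\<dots> = ennreal (\<Prod>i\<in>UNIV. fact (2 * k i) / ((2 * d $ i) ^ k i * fact (k i)))"
    unfolding mom using d by (intro prod_ennreal) (auto simp: less_imp_le)
  finally show ?thesis .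
qed

lemma prob_space_normal_vec:
  fixes d :: "real^'n"
  assumes d: "\<And>i. 0 < d $ i"
  shows "prob_space (normal_vec d)"
  using nn_integral_normal_vec_moment[OF d, of "\<lambda>_. 0"] by (intro prob_spaceI) simp

lemma nn_integral_normal_vec_square:
  fixes d :: "real^'n"
  assumes d: "\<And>i. 0 < d $ i"
  shows "(\<integral>\<^sup>+y. ennreal ((y $ a)\<^sup>2) \<partial>normal_vec d) = ennreal (1 / d $ a)"
proof -
  let ?k = "\<lambda>i. if i = a then 1 else 0 :: nat"
  have "(y $ a)\<^sup>2 = (\<Prod>i\<in>UNIV. (y $ i) ^ (2 * ?k i))" for y :: "real^'n"
    by (simp add: if_distrib[of "\<lambda>k. _ ^ k"] if_distrib[of "\<lambda>k. 2 * k"] cong: if_cong)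
  moreover have "(\<Prod>i\<in>UNIV. fact (2 * ?k i) / ((2 * d $ i) ^ ?k i * fact (?k i)))
      = (\<Prod>i\<in>UNIV. if i = a then 1 / d $ i else 1)"
    by (rule prod.cong) (auto simp: fact_numeral)
  ultimately show ?thesis by (simp only: nn_integral_normal_vec_moment[OF d]) simp
qed

lemma nn_integral_normal_vec_square_square:
  fixes d :: "real^'n"
  assumes d: "\<And>i. 0 < d $ i"
  shows "(\<integral>\<^sup>+y. ennreal ((y $ a)\<^sup>2 * (y $ b)\<^sup>2) \<partial>normal_vec d)
    = ennreal ((if a = b then 3 else 1) / (d $ a * d $ b))"
proof -
  let ?\<delta> = "\<lambda>a i. if i = a then 1 else 0 :: nat"
  \<comment> \<open>Counts how often a coordinate occurs among \<open>a\<close> and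
    \<open>b\<close>. A repeated index gives the fourth moment with its factor 4! / (2^2 2!) = 3,
    distinct ones two second moments.\<close>
  let ?k = "\<lambda>i. ?\<delta> a i + ?\<delta> b i"
  have "(y $ c)\<^sup>2 = (\<Prod>i\<in>UNIV. (y $ i) ^ (2 * ?\<delta> c i))" for y :: "real^'n" and c
    by (simp add: if_distrib[of "\<lambda>k. _ ^ k"] if_distrib[of "\<lambda>k. 2 * k"] cong: if_cong)
  then have "(y $ a)\<^sup>2 * (y $ b)\<^sup>2 = (\<Prod>i\<in>UNIV. (y $ i) ^ (2 * ?k i))" for y :: "real^'n"
    unfolding distrib_left power_add prod.distrib by presburger
  moreover have "(\<Prod>i\<in>UNIV. fact (2 * ?k i) / ((2 * d $ i) ^ ?k i * fact (?k i)))
      = (if a = b then 3 else 1) / (d $ a * d $ b)"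
  proof (cases "a = b")
    case True
    have "(\<Prod>i\<in>UNIV. fact (2 * ?k i) / ((2 * d $ i) ^ ?k i * fact (?k i)))
      = (\<Prod>i\<in>UNIV. if i = a then 3 / (d $ i * d $ i) else 1)"
      using True by (intro prod.cong) (auto simp: fact_numeral numeral_2_eq_2[symmetric] power2_eq_square)
    then show ?thesis using True by simp
  next
    case False
    have "(\<Prod>i\<in>UNIV. fact (2 * ?k i) / ((2 * d $ i) ^ ?k i * fact (?k i)))
      = (\<Prod>i\<in>UNIV. (if i = a then 1 / d $ i else 1) * (if i = b then 1 / d $ i else 1))"
      using False by (intro prod.cong) (auto simp: fact_numeral)
    then show ?thesis using False by (simp add: prod.distrib)
  qed
  ultimately show ?thesis by (simp only: nn_integral_normal_vec_moment[OF d])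
qed

lemma integrable_normal_vec_prod:
  fixes d :: "real^'n"
  assumes d: "\<And>i. 0 < d $ i"
  shows "integrable (normal_vec d) (\<lambda>y. y $ a * y $ b)"
proof -
  have sq: "integrable (normal_vec d) (\<lambda>y. (y $ c)\<^sup>2)" for c
    by (rule integrableI_nonneg) (auto simp: nn_integral_normal_vec_square[OF d])
  have "\<bar>x * y\<bar> \<le> x\<^sup>2 + y\<^sup>2" for x y :: real
  proof -
    have "0 \<le> \<bar>x\<bar> * \<bar>y\<bar>" by simp
    then show ?thesis using sum_squares_bound[of "\<bar>x\<bar>" "\<bar>y\<bar>"]
      unfolding abs_mult power2_abs by linarith
  qed
  then show ?thesis
    by (intro Bochner_Integration.integrable_bound[OF Bochner_Integration.integrable_add[OF sq[of a] sq[of b]]])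
      auto
qed

text \<open>Off the diagonal, the covariance changes sign under the reflection of one coordinate.\<close>

lemma integral_normal_vec_prod:
  fixes d :: "real^'n"
  assumes d: "\<And>i. 0 < d $ i"
  shows "(\<integral>y. y $ a * y $ b \<partial>normal_vec d) = (if a = b then 1 / d $ a else 0)"
proof (cases "a = b")
  case True
  then show ?thesis
    using d[of a] by (subst integral_eq_nn_integral)
      (auto simp: power2_eq_square[symmetric] nn_integral_normal_vec_square[OF d] less_imp_le)
next
  case False
  define s :: "real^'n" where "s = (\<chi> i. if i = a then - 1 else 1)"
  have F: "orthogonal_matrix (diag_mat s)"
  proof -
    have "(\<chi> i. s $ i * s $ i) = (\<chi> i. 1)" by (simp add: s_def vec_eq_iff)
    then show ?thesis
      by (simp add: orthogonal_matrix transpose_diag_mat diag_mat_mult_diag_mat diag_mat_one)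
  qed
  let ?f = "\<lambda>y :: real^'n. ennreal (\<Prod>i\<in>UNIV. normal_density 0 (1 / sqrt (d $ i)) (y $ i))"
  have "normal_density 0 \<sigma> ((diag_mat s *v y) $ i) = normal_density 0 \<sigma> (y $ i)" for \<sigma> y i
    by (simp add: diag_mat_mult_vec s_def normal_density_def)
  then have "?f (diag_mat s *v y) = ?f y" for y by simp
  then have "distr (normal_vec d) borel ((*v) (diag_mat s)) = distr (density lborel (\<lambda>y. ?f (diag_mat s *v y))) borel ((*v) (diag_mat s))"
    by (simp add: normal_vec_def)
  also have "\<dots> = density (distr lborel borel ((*v) (diag_mat s))) ?f"
    by (rule density_distr[symmetric]) auto
  also have "\<dots> = normal_vec d"
    by (simp add: lborel_distr_orthogonal[OF F] normal_vec_def)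
  finally have "(\<integral>y. y $ a * y $ b \<partial>normal_vec d) = (\<integral>y. y $ a * y $ b \<partial>distr (normal_vec d) borel ((*v) (diag_mat s)))"
    by simp
  also have "\<dots> = (\<integral>y. - (y $ a * y $ b) \<partial>normal_vec d)"
    using False by (subst integral_distr) (auto simp: diag_mat_mult_vec s_def intro!: Bochner_Integration.integral_cong)
  finally show ?thesis using False by simp
qed

text \<open>In terms of the precision matrix the density is jointly continuous, which makes the
  transition kernel of the chain measurable.\<close>

definition gauss_dens :: "real^'n^'n \<Rightarrow> real^'n \<Rightarrow> real" where
  "gauss_dens \<theta> x = exp (- (1 / 2) * (x \<bullet> (\<theta> *v x))) * sqrt (det \<theta>) / sqrt ((2 * pi) ^ CARD('n))"

lemma gaussian_matrix_inv_eq_density: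
  assumes "\<theta> \<in> pd_mats"
  shows "gaussian (matrix_inv \<theta>) = density lborel (\<lambda>x. ennreal (gauss_dens \<theta> x))"
  unfolding gaussian_def gauss_dens_def using matrix_inv_pd[OF assms]
  by (simp add: real_sqrt_divide)

lemma sets_gaussian [measurable_cong, simp]: "sets (gaussian C) = sets borel"
  by (simp add: gaussian_def)

text \<open>The rotation x = Q y preserves Lebesgue measure and diagonalises the quadratic form, so
  the density splits into one-dimensional normal densities.\<close>

lemma gaussian_eq_distr_normal_vec:
  fixes Q :: "real^'n^'n"
  assumes \<theta>: "\<theta> \<in> pd_mats" and Q: "orthogonal_matrix Q" and qd: "\<theta> = Q ** diag_mat d ** transpose Q"
  shows "gaussian (matrix_inv \<theta>) = distr (normal_vec d) borel ((*v) Q)"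
proof -
  note d = pd_mats_spectral_pos[OF \<theta> Q qd]
  have "det Q * det (transpose Q) = 1"
    using orthogonal_matrix_cancel(2)[OF Q] by (metis det_I det_mul)
  then have det: "det \<theta> = (\<Prod>i\<in>UNIV. d $ i)" unfolding qd by (simp add: det_mul det_diag_mat)
  have quad: "(Q *v y) \<bullet> (\<theta> *v (Q *v y)) = (\<Sum>i\<in>UNIV. d $ i * (y $ i)\<^sup>2)" for y
    unfolding qd quadratic_form_spectral by (simp add: orthogonal_matrix_cancel[OF Q])
  have nd: "normal_density 0 (1 / sqrt (d $ i)) t = exp (- (1 / 2) * (d $ i * t\<^sup>2)) * sqrt (d $ i) / sqrt (2 * pi)" for i t
    using d[of i] by (simp add: normal_density_def real_sqrt_divide power_divide)
  have eq: "gauss_dens \<theta> (Q *v y) = (\<Prod>i\<in>UNIV. normal_density 0 (1 / sqrt (d $ i)) (y $ i))" for y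
    unfolding gauss_dens_def quad det nd real_sqrt_power
    by (simp add: prod_dividef prod.distrib exp_sum[symmetric] sum_distrib_left
        sum_negf sqrt_prod)
  have m: "gauss_dens \<theta> \<in> borel_measurable borel"
    unfolding gauss_dens_def
    by (intro borel_measurable_continuous_onI continuous_intros) auto
  have "gaussian (matrix_inv \<theta>) = density (distr lborel borel ((*v) Q)) (\<lambda>x. ennreal (gauss_dens \<theta> x))"
    by (simp add: gaussian_matrix_inv_eq_density[OF \<theta>] lborel_distr_orthogonal[OF Q])
  also have "\<dots> = distr (density lborel (\<lambda>y. ennreal (gauss_dens \<theta> (Q *v y)))) borel ((*v) Q)"
    using m by (intro density_distr) auto
  finally show ?thesis by (simp add: eq normal_vec_def)
qed

lemma prob_space_gaussian:
  assumes "\<theta> \<in> pd_mats"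
  shows "prob_space (gaussian (matrix_inv \<theta>))"
proof -
  obtain Q d where Q: "orthogonal_matrix Q" and qd: "\<theta> = Q ** diag_mat d ** transpose Q"
    using assms sym_mats_spectral by (auto simp: pd_mats_def)
  interpret prob_space "normal_vec d"
    using pd_mats_spectral_pos[OF assms Q qd] by (rule prob_space_normal_vec)
  show ?thesis
    unfolding gaussian_eq_distr_normal_vec[OF assms Q qd] by (rule prob_space_distr) simp
qed

lemma gaussian_covariance:
  fixes \<theta> :: "real^'n^'n"
  assumes \<theta>: "\<theta> \<in> pd_mats"
  shows "integrable (gaussian (matrix_inv \<theta>)) (\<lambda>x. x $ a * x $ b)"
    "(\<integral>x. x $ a * x $ b \<partial>gaussian (matrix_inv \<theta>)) = matrix_inv \<theta> $ a $ b"
proof -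
  obtain Q d where Q: "orthogonal_matrix Q" and qd: "\<theta> = Q ** diag_mat d ** transpose Q"
    using \<theta> sym_mats_spectral by (auto simp: pd_mats_def)
  note d = pd_mats_spectral_pos[OF \<theta> Q qd]
  have expand: "(Q *v y) $ a * (Q *v y) $ b = (\<Sum>i\<in>UNIV. \<Sum>j\<in>UNIV. Q $ a $ i * Q $ b $ j * (y $ i * y $ j))" for y
    by (simp add: matrix_vector_mult_def sum_product mult_ac)
  note int = integrable_normal_vec_prod[OF d]
  have "integrable (normal_vec d) (\<lambda>y. (Q *v y) $ a * (Q *v y) $ b)"
    unfolding expand by (intro Bochner_Integration.integrable_sum Bochner_Integration.integrable_mult_right int)
  then show "integrable (gaussian (matrix_inv \<theta>)) (\<lambda>x. x $ a * x $ b)"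
    unfolding gaussian_eq_distr_normal_vec[OF \<theta> Q qd] by (subst integrable_distr_eq) auto
  have "(\<integral>x. x $ a * x $ b \<partial>gaussian (matrix_inv \<theta>)) = (\<integral>y. (Q *v y) $ a * (Q *v y) $ b \<partial>normal_vec d)"
    unfolding gaussian_eq_distr_normal_vec[OF \<theta> Q qd] by (subst integral_distr) auto
  also have "\<dots> = (\<Sum>i\<in>UNIV. \<Sum>j\<in>UNIV. Q $ a $ i * Q $ b $ j * (\<integral>y. y $ i * y $ j \<partial>normal_vec d))"
    unfolding expand
    by (simp add: Bochner_Integration.integral_sum Bochner_Integration.integrable_sum int)
  also have "\<dots> = (Q ** diag_mat (\<chi> i. 1 / d $ i) ** transpose Q) $ a $ b"
    unfolding integral_normal_vec_prod[OF d]
    by (subst matrix_matrix_mult_def)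
      (simp add: mult_diag_mat transpose_def if_distrib[of "\<lambda>c. _ * c"] mult_ac cong: if_cong)
  also have "\<dots> = matrix_inv \<theta> $ a $ b"
    unfolding qd using d by (simp add: matrix_inv_spectral[OF Q] less_imp_neq[symmetric])
  finally show "(\<integral>x. x $ a * x $ b \<partial>gaussian (matrix_inv \<theta>)) = matrix_inv \<theta> $ a $ b" .
qed

text \<open>After rotation the norm expands into squares over p^2 index pairs, each contributing at
  most 1 / l^2; the p diagonal pairs contribute up to two units more, hence p^2 + 2 p.\<close>

lemma gaussian_fourth_moment:
  fixes \<theta> :: "real^'n^'n"
  assumes l: "0 < l" and \<theta>: "\<theta> \<in> pd_mats_between l \<psi>"
  shows "(\<integral>\<^sup>+x. ennreal (norm x ^ 4) \<partial>gaussian (matrix_inv \<theta>))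
    \<le> ennreal (((real CARD('n))\<^sup>2 + 2 * real CARD('n)) / l\<^sup>2)"
proof -
  have pd: "\<theta> \<in> pd_mats" using \<theta> by (simp add: pd_mats_between_def)
  obtain Q d where Q: "orthogonal_matrix Q" and qd: "\<theta> = Q ** diag_mat d ** transpose Q"
    using pd sym_mats_spectral by (auto simp: pd_mats_def)
  note d = pd_mats_spectral_pos[OF pd Q qd] and ld = pd_mats_between_spectral(1)[OF \<theta> Q qd]
  have expand: "norm (Q *v y) ^ 4 = (\<Sum>a\<in>UNIV. \<Sum>b\<in>UNIV. (y $ a)\<^sup>2 * (y $ b)\<^sup>2)" for y
  proof -
    have "norm (Q *v y) ^ 4 = (norm y)\<^sup>2 * (norm y)\<^sup>2"
      by (simp add: norm_orthogonal_matrix_mult_vec[OF Q] power2_eq_square power4_eq_xxxx mult_ac)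
    also have "(norm y)\<^sup>2 = (\<Sum>a\<in>UNIV. (y $ a)\<^sup>2)"
      unfolding power2_norm_eq_inner by (simp add: inner_vec_def power2_eq_square)
    finally show ?thesis by (simp add: sum_product)
  qed
  have "(\<integral>\<^sup>+x. ennreal (norm x ^ 4) \<partial>gaussian (matrix_inv \<theta>))
      = (\<integral>\<^sup>+y. (\<Sum>a\<in>UNIV. \<Sum>b\<in>UNIV. ennreal ((y $ a)\<^sup>2 * (y $ b)\<^sup>2)) \<partial>normal_vec d)"
    unfolding gaussian_eq_distr_normal_vec[OF pd Q qd]
    by (subst nn_integral_distr) (auto simp: expand sum_nonneg)
  also have "\<dots> = (\<Sum>a\<in>UNIV. \<Sum>b\<in>UNIV. ennreal ((if a = b then 3 else 1) / (d $ a * d $ b)))"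
    by (simp add: nn_integral_sum nn_integral_normal_vec_square_square[OF d] del: sum_ennreal)
  also have "\<dots> \<le> (\<Sum>a\<in>(UNIV::'n set). \<Sum>b\<in>(UNIV::'n set). ennreal ((if a = b then 3 else 1) / l\<^sup>2))"
    unfolding power2_eq_square
    using l ld d by (intro sum_mono ennreal_leI divide_left_mono mult_mono mult_pos_pos) (auto simp: less_imp_le)
  also have "\<dots> = ennreal (\<Sum>a\<in>(UNIV::'n set). \<Sum>b\<in>(UNIV::'n set). (if a = b then 3 else 1) / l\<^sup>2)"
    by (simp add: sum_nonneg)
  also have "(\<Sum>a\<in>(UNIV::'n set). \<Sum>b\<in>(UNIV::'n set). (if a = b then 3 else 1) / l\<^sup>2)
      = (\<Sum>a\<in>(UNIV::'n set). \<Sum>b\<in>(UNIV::'n set). 1 / l\<^sup>2 + (if a = b then 2 / l\<^sup>2 else 0))"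
    by (intro sum.cong refl) (simp add: add_divide_distrib[symmetric])
  also have "\<dots> = ((real CARD('n))\<^sup>2 + 2 * real CARD('n)) / l\<^sup>2"
    by (simp add: sum.distrib power2_eq_square add_divide_distrib distrib_left)
  finally show ?thesis .
qed

section \<open>One step of the chain from a fixed state\<close>

text \<open>Centring removes the term linear in the noise. What remains is the variance, bounded by
  the raw second moment after discarding the squared mean.\<close>

lemma (in prob_space) nn_integral_centred_step:
  fixes f :: "'a \<Rightarrow> 'b::euclidean_space"
  assumes f: "integrable M f" and B: "(\<integral>\<^sup>+x. ennreal ((norm (f x))\<^sup>2) \<partial>M) \<le> ennreal B" "0 \<le> B"
  shows "(\<integral>\<^sup>+x. ennreal ((norm (Z + c *\<^sub>R (f x - expectation f)))\<^sup>2) \<partial>M) \<le> ennreal ((norm Z)\<^sup>2 + c\<^sup>2 * B)"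
proof -
  let ?m = "expectation f"
  define V where "V = Z - c *\<^sub>R ?m"
  have [measurable]: "f \<in> borel_measurable M" using f by simp
  have sq: "integrable M (\<lambda>x. (norm (f x))\<^sup>2)"
    using B by (intro integrableI_nonneg) (auto simp: top.not_eq_extremum[symmetric] neq_top_trans[OF ennreal_neq_top])
  have sqB: "expectation (\<lambda>x. (norm (f x))\<^sup>2) \<le> B"
    using B nn_integral_eq_integral[OF sq] by (simp add: integral_nonneg_AE)
  have expand: "(norm (Z + c *\<^sub>R (f x - ?m)))\<^sup>2 = (norm V)\<^sup>2 + 2 * c * (V \<bullet> f x) + c\<^sup>2 * (norm (f x))\<^sup>2" for x
  proof -
    have "Z + c *\<^sub>R (f x - ?m) = V + c *\<^sub>R f x" by (simp add: V_def algebra_simps)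
    then show ?thesis
      unfolding power2_norm_eq_inner by (simp add: inner_add_left inner_add_right inner_commute[of "f x" V] power2_eq_square algebra_simps)
  qed
  have int: "integrable M (\<lambda>x. (norm V)\<^sup>2 + 2 * c * (V \<bullet> f x) + c\<^sup>2 * (norm (f x))\<^sup>2)"
    using f sq by simp
  have "(\<integral>\<^sup>+x. ennreal ((norm (Z + c *\<^sub>R (f x - ?m)))\<^sup>2) \<partial>M)
      = ennreal (\<integral>x. (norm V)\<^sup>2 + 2 * c * (V \<bullet> f x) + c\<^sup>2 * (norm (f x))\<^sup>2 \<partial>M)"
    unfolding expand by (rule nn_integral_eq_integral[OF int]) (simp flip: expand)
  also have "(\<integral>x. (norm V)\<^sup>2 + 2 * c * (V \<bullet> f x) + c\<^sup>2 * (norm (f x))\<^sup>2 \<partial>M)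
      = (norm V)\<^sup>2 + 2 * c * (V \<bullet> ?m) + c\<^sup>2 * expectation (\<lambda>x. (norm (f x))\<^sup>2)"
    using f sq by (simp add: prob_space)
  also have "\<dots> \<le> (norm V)\<^sup>2 + 2 * c * (V \<bullet> ?m) + c\<^sup>2 * B"
    using sqB by (simp add: mult_left_mono)
  also have "\<dots> = (norm Z)\<^sup>2 - c\<^sup>2 * (norm ?m)\<^sup>2 + c\<^sup>2 * B"
    unfolding V_def power2_norm_eq_inner by (simp add: inner_diff_left inner_diff_right inner_commute[of ?m Z]
      power2_eq_square algebra_simps)
  also have "\<dots> \<le> (norm Z)\<^sup>2 + c\<^sup>2 * B" by simp
  finally show ?thesis by (simp add: ennreal_leI)
qed

text \<open>Coordinates are integrated out one at a time, the partial sum of the others joining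
  \<open>Z\<close> as a constant. Independence enters as the product measure, so variances add up to
  a multiple of \<open>card I\<close>.\<close>

lemma (in prob_space) nn_integral_PiM_centred_sum:
  fixes f :: "'a \<Rightarrow> 'b::euclidean_space"
  assumes f: "integrable M f" and B: "(\<integral>\<^sup>+x. ennreal ((norm (f x))\<^sup>2) \<partial>M) \<le> ennreal B" "0 \<le> B"
    and I: "finite I"
  shows "(\<integral>\<^sup>+x. ennreal ((norm (Z + c *\<^sub>R (\<Sum>j\<in>I. f (x j) - expectation f)))\<^sup>2) \<partial>Pi\<^sub>M I (\<lambda>_. M))
    \<le> ennreal ((norm Z)\<^sup>2 + real (card I) * (c\<^sup>2 * B))"
  using I
proof (induction I)
  case empty
  interpret P: prob_space "Pi\<^sub>M {} (\<lambda>_. M)" by (rule prob_space_PiM) (rule prob_space_axioms)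
  show ?case by (simp add: P.emeasure_space_1)
next
  case (insert i I)
  interpret P: prob_space "Pi\<^sub>M I (\<lambda>_. M)" by (rule prob_space_PiM) (rule prob_space_axioms)
  interpret product_sigma_finite "\<lambda>_. M" ..
  have [measurable]: "f \<in> borel_measurable M" using f by simp
  let ?m = "expectation f"
  have upd: "(\<Sum>j\<in>insert i I. f ((x(i := y)) j) - ?m) = (f y - ?m) + (\<Sum>j\<in>I. f (x j) - ?m)" for x y
    using insert by (simp, intro sum.cong) auto
  have "(\<integral>\<^sup>+x. ennreal ((norm (Z + c *\<^sub>R (\<Sum>j\<in>insert i I. f (x j) - ?m)))\<^sup>2) \<partial>Pi\<^sub>M (insert i I) (\<lambda>_. M))
    = (\<integral>\<^sup>+x. (\<integral>\<^sup>+y. ennreal ((norm (Z + c *\<^sub>R (\<Sum>j\<in>insert i I. f ((x(i := y)) j) - ?m)))\<^sup>2) \<partial>M) \<partial>Pi\<^sub>M I (\<lambda>_. M))"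
    using insert by (intro product_nn_integral_insert) auto
  also have "\<dots> = (\<integral>\<^sup>+x. (\<integral>\<^sup>+y. ennreal ((norm ((Z + c *\<^sub>R (\<Sum>j\<in>I. f (x j) - ?m)) + c *\<^sub>R (f y - ?m)))\<^sup>2) \<partial>M) \<partial>Pi\<^sub>M I (\<lambda>_. M))"
    unfolding upd by (simp add: scaleR_add_right add_ac)
  also have "\<dots> \<le> (\<integral>\<^sup>+x. ennreal ((norm (Z + c *\<^sub>R (\<Sum>j\<in>I. f (x j) - ?m)))\<^sup>2) + ennreal (c\<^sup>2 * B) \<partial>Pi\<^sub>M I (\<lambda>_. M))"
    using B by (intro nn_integral_mono order_trans[OF nn_integral_centred_step[OF f B]]) simp
  also have "\<dots> = (\<integral>\<^sup>+x. ennreal ((norm (Z + c *\<^sub>R (\<Sum>j\<in>I. f (x j) - ?m)))\<^sup>2) \<partial>Pi\<^sub>M I (\<lambda>_. M)) + ennreal (c\<^sup>2 * B)"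
    by (subst nn_integral_add) (auto simp: P.emeasure_space_1)
  also have "\<dots> \<le> ennreal ((norm Z)\<^sup>2 + real (card I) * (c\<^sup>2 * B)) + ennreal (c\<^sup>2 * B)"
    using insert.IH by (intro add_right_mono)
  also have "\<dots> = ennreal ((norm Z)\<^sup>2 + real (card (insert i I)) * (c\<^sup>2 * B))"
    using B insert by (simp add: algebra_simps flip: ennreal_plus)
  finally show ?case .
qed

lemma norm_outer_square: "norm (outer_square x) = (norm x)\<^sup>2"
proof -
  have "(norm (outer_square x))\<^sup>2 = (\<Sum>i\<in>UNIV. (x $ i)\<^sup>2) * (\<Sum>j\<in>UNIV. (x $ j)\<^sup>2)"
    by (simp add: norm_matrix_squared outer_square_def power_mult_distrib sum_product)
  also have "(\<Sum>i\<in>UNIV. (x $ i)\<^sup>2) = (norm x)\<^sup>2"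
    unfolding power2_norm_eq_inner by (simp add: inner_vec_def power2_eq_square)
  finally show ?thesis by (metis norm_ge_zero power2_eq_imp_eq power2_eq_square zero_le_power2)
qed

lemma measurable_outer_square [measurable]: "outer_square \<in> borel_measurable borel"
  unfolding outer_square_def by (intro borel_measurable_continuous_onI continuous_intros)

text \<open>The fourth moment bound \<open>(p\<^sup>2 + 2 p) / l\<^sup>2\<close> is below \<open>2 (p + p\<^sup>2) / l\<^sup>2\<close>, so the constant of the
  theorem leaves slack.\<close>

lemma nn_integral_sample_cov_step:
  fixes \<theta> Z :: "real^'n^'n"
  assumes l: "0 < l" and \<theta>: "\<theta> \<in> pd_mats_between l \<psi>" and n: "1 \<le> n"
  shows "(\<integral>\<^sup>+x. ennreal ((norm (Z + \<gamma> *\<^sub>R (sample_cov n x - matrix_inv \<theta>)))\<^sup>2)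
      \<partial>Pi\<^sub>M {1..n} (\<lambda>_. gaussian (matrix_inv \<theta>)))
    \<le> ennreal ((norm Z)\<^sup>2 + 2 * \<gamma>\<^sup>2 * (1 / l\<^sup>2) * (real CARD('n) + (real CARD('n))\<^sup>2) * (1 / real n))"
proof -
  define p where "p = real CARD('n)"
  define B where "B = 2 * (p + p\<^sup>2) / l\<^sup>2"
  have pd: "\<theta> \<in> pd_mats" using \<theta> by (simp add: pd_mats_between_def)
  interpret prob_space "gaussian (matrix_inv \<theta>)" by (rule prob_space_gaussian[OF pd])
  have "(\<integral>\<^sup>+x. ennreal ((norm (outer_square x))\<^sup>2) \<partial>gaussian (matrix_inv \<theta>)) \<le> ennreal ((p\<^sup>2 + 2 * p) / l\<^sup>2)"
    using gaussian_fourth_moment[OF l \<theta>] by (simp add: norm_outer_square p_def)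
  also have "\<dots> \<le> ennreal B"
    unfolding B_def by (intro ennreal_leI divide_right_mono) (auto simp: p_def)
  finally have B: "(\<integral>\<^sup>+x. ennreal ((norm (outer_square x))\<^sup>2) \<partial>gaussian (matrix_inv \<theta>)) \<le> ennreal B" "0 \<le> B"
    by (auto simp: B_def p_def)
  \<comment> \<open>The trace of \<open>outer_square x\<close> equals its norm, so integrability
    follows from that of the diagonal entries.\<close>
  have "integrable (gaussian (matrix_inv \<theta>)) (\<lambda>x. \<Sum>i\<in>UNIV. x $ i * x $ i)"
    by (intro Bochner_Integration.integrable_sum gaussian_covariance pd)
  then have int: "integrable (gaussian (matrix_inv \<theta>)) outer_square"
    by (rule Bochner_Integration.integrable_bound)
      (auto simp: norm_outer_square power2_norm_eq_inner inner_vec_def)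
  have "expectation outer_square $ a $ b = matrix_inv \<theta> $ a $ b" for a b
  proof -
    have bl: "bounded_linear (\<lambda>A :: real^'n^'n. A $ a $ b)"
      by (intro bounded_linear_compose[OF bounded_linear_vec_nth bounded_linear_vec_nth])
    have "expectation (\<lambda>x. outer_square x $ a $ b) = expectation outer_square $ a $ b"
      by (rule integral_bounded_linear[OF bl int])
    then show ?thesis by (simp add: outer_square_def gaussian_covariance[OF pd])
  qed
  then have mean: "expectation outer_square = matrix_inv \<theta>" by (simp add: vec_eq_iff)
  have "sample_cov n x - matrix_inv \<theta> = (1 / real n) *\<^sub>R (\<Sum>j\<in>{1..n}. outer_square (x j) - matrix_inv \<theta>)" for x
    using n by (simp add: sample_cov_def sum_subtractf scaleR_diff_right sum_constant_scaleR del: sum_constant)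
  then have eq: "Z + \<gamma> *\<^sub>R (sample_cov n x - matrix_inv \<theta>)
      = Z + (\<gamma> / real n) *\<^sub>R (\<Sum>j\<in>{1..n}. outer_square (x j) - expectation outer_square)" for x
    by (simp add: mean)
  have "(\<integral>\<^sup>+x. ennreal ((norm (Z + \<gamma> *\<^sub>R (sample_cov n x - matrix_inv \<theta>)))\<^sup>2)
      \<partial>Pi\<^sub>M {1..n} (\<lambda>_. gaussian (matrix_inv \<theta>)))
    \<le> ennreal ((norm Z)\<^sup>2 + real (card {1..n}) * ((\<gamma> / real n)\<^sup>2 * B))"
    unfolding eq by (rule nn_integral_PiM_centred_sum[OF int B]) simp
  \<comment> \<open>There are n independent terms with coefficient \<gamma> / n, hence n (\<gamma> /
    n)^2 = \<gamma>^2 / n.\<close>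
  also have "real (card {1..n}) * ((\<gamma> / real n)\<^sup>2 * B) = 2 * \<gamma>\<^sup>2 * (1 / l\<^sup>2) * (p + p\<^sup>2) * (1 / real n)"
    using n by (simp add: B_def power2_eq_square algebra_simps)
  finally show ?thesis by (simp add: p_def)
qed

text \<open>Boxes form an intersection-stable generator of the product sigma-algebra and include the
  whole space, so a finite measure is determined by its values on them. This lifts the assumption on
  the draws from rectangles to the joint law of state and draws.\<close>

lemma measure_eqI_pair_PiM:
  assumes I: "finite I"
    and sets: "sets m1 = sets (M \<Otimes>\<^sub>M Pi\<^sub>M I N)" "sets m2 = sets (M \<Otimes>\<^sub>M Pi\<^sub>M I N)"
    and eq: "\<And>A B. A \<in> sets M \<Longrightarrow> (\<And>i. i \<in> I \<Longrightarrow> B i \<in> sets (N i)) \<Longrightarrow>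
      emeasure m1 (A \<times> (\<Pi>\<^sub>E i\<in>I. B i)) = emeasure m2 (A \<times> (\<Pi>\<^sub>E i\<in>I. B i))"
    and fin: "emeasure m1 (space m1) \<noteq> \<infinity>"
  shows "m1 = m2"
proof -
  let ?\<Omega> = "space M \<times> (\<Pi>\<^sub>E i\<in>I. space (N i))"
  let ?E = "{A \<times> X | A X. A \<in> sets M \<and> X \<in> prod_algebra I N}"
  have E: "?E \<subseteq> Pow ?\<Omega>"
    using prod_algebra_sets_into_space[of I N] sets.sets_into_space[of _ M] by blast
  have *: "sets (M \<Otimes>\<^sub>M Pi\<^sub>M I N) = sigma_sets ?\<Omega> ?E"
  proof -
    have "sets (M \<Otimes>\<^sub>M Pi\<^sub>M I N) = sets (sigma (space M \<times> space (Pi\<^sub>M I N)) ?E)"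
    proof (rule sets_pair_eq)
      show "sets M \<subseteq> Pow (space M)" by (rule sets.space_closed)
      show "sets M = sigma_sets (space M) (sets M)" by (simp add: sets.sigma_sets_eq)
      show "prod_algebra I N \<subseteq> Pow (space (Pi\<^sub>M I N))"
        unfolding space_PiM by (rule prod_algebra_sets_into_space)
      show "sets (Pi\<^sub>M I N) = sigma_sets (space (Pi\<^sub>M I N)) (prod_algebra I N)"
        unfolding space_PiM by (rule sets_PiM)
      show "{space M} \<subseteq> sets M" "{space (Pi\<^sub>M I N)} \<subseteq> prod_algebra I N"
        using I by (auto simp: prod_algebra_eq_finite space_PiM)
    qed auto
    then show ?thesis
      unfolding space_PiM
      by (simp only: sets_measure_of[OF E])
  qed
  show ?thesis
  proof (rule measure_eqI_generator_eq)
    show "Int_stable ?E"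
    proof (rule Int_stableI)
      fix a b assume "a \<in> ?E" "b \<in> ?E"
      then obtain A X A' X' where "a = A \<times> X" "b = A' \<times> X'" "A \<in> sets M" "A' \<in> sets M"
        "X \<in> prod_algebra I N" "X' \<in> prod_algebra I N" by auto
      then show "a \<inter> b \<in> ?E"
        using Int_stable_prod_algebra[of I N] unfolding Int_stable_def
        by (auto simp: Times_Int_Times)
    qed
    show "?E \<subseteq> Pow ?\<Omega>" by (fact E)
    show "sets m1 = sigma_sets ?\<Omega> ?E" "sets m2 = sigma_sets ?\<Omega> ?E" using sets * by auto
    show "emeasure m1 X = emeasure m2 X" if "X \<in> ?E" for X
      using that eq by (auto simp: prod_algebra_eq_finite[OF I])
    have "?\<Omega> \<in> ?E" using I by (auto simp: prod_algebra_eq_finite)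
    then show "range (\<lambda>_ :: nat. ?\<Omega>) \<subseteq> ?E" by auto
    show "emeasure m1 ?\<Omega> \<noteq> \<infinity>" for i :: nat
      using fin sets_eq_imp_space_eq[OF sets(1)] by (simp add: space_pair_measure space_PiM)
  qed auto
qed

section \<open>The conditional law of the draws\<close>

lemma measurable_gauss_dens:
  "(\<lambda>p. gauss_dens (fst p) (snd p)) \<in> borel_measurable (borel \<Otimes>\<^sub>M (borel :: (real^'n) measure))"
  unfolding borel_prod gauss_dens_def det_def matrix_vector_mult_def inner_vec_def
  by (intro borel_measurable_continuous_onI continuous_intros) auto

text \<open>Moves the dependence on \<theta> from the measure into a density against a fixed
  reference measure, so that Tonelli applies when \<theta> becomes random.\<close>

lemma PiM_gaussian_eq_density:
  assumes \<theta>: "\<theta> \<in> pd_mats" and I: "finite I"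
  shows "Pi\<^sub>M I (\<lambda>_. gaussian (matrix_inv \<theta>))
    = density (Pi\<^sub>M I (\<lambda>_. lborel)) (\<lambda>x. \<Prod>j\<in>I. ennreal (gauss_dens \<theta> (x j)))"
proof (rule sym, rule product_sigma_finite.PiM_eqI)
  interpret prob_space "gaussian (matrix_inv \<theta>)" by (rule prob_space_gaussian[OF \<theta>])
  interpret L: product_sigma_finite "\<lambda>_. lborel :: (real^'a) measure" ..
  show "product_sigma_finite (\<lambda>_. gaussian (matrix_inv \<theta>))" ..
  have m [measurable]: "gauss_dens \<theta> \<in> borel_measurable borel"
    using measurable_Pair2[OF measurable_gauss_dens, of \<theta>] by simp
  show "sets (density (Pi\<^sub>M I (\<lambda>_. lborel)) (\<lambda>x. \<Prod>j\<in>I. ennreal (gauss_dens \<theta> (x j))))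
      = sets (Pi\<^sub>M I (\<lambda>_. gaussian (matrix_inv \<theta>)))"
    by (auto intro!: sets_PiM_cong)
  fix A assume A: "\<And>i. i \<in> I \<Longrightarrow> A i \<in> sets (gaussian (matrix_inv \<theta>))"
  then have [measurable]: "\<And>i. i \<in> I \<Longrightarrow> A i \<in> sets borel" by simp
  have PA: "Pi\<^sub>E I A \<in> sets (Pi\<^sub>M I (\<lambda>_. lborel))"
    using A I by (intro sets_PiM_I_finite) auto
  have "emeasure (density (Pi\<^sub>M I (\<lambda>_. lborel)) (\<lambda>x. \<Prod>j\<in>I. ennreal (gauss_dens \<theta> (x j)))) (Pi\<^sub>E I A)
      = (\<integral>\<^sup>+x. (\<Prod>j\<in>I. ennreal (gauss_dens \<theta> (x j))) * indicator (Pi\<^sub>E I A) x \<partial>Pi\<^sub>M I (\<lambda>_. lborel))"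
    using I PA by (subst emeasure_density) auto
  also have "\<dots> = (\<integral>\<^sup>+x. (\<Prod>j\<in>I. ennreal (gauss_dens \<theta> (x j)) * indicator (A j) (x j)) \<partial>Pi\<^sub>M I (\<lambda>_. lborel))"
  proof (rule nn_integral_cong)
    fix x assume "x \<in> space (Pi\<^sub>M I (\<lambda>_. lborel :: (real^'a) measure))"
    \<comment> \<open>Membership in the extensional product also constrains \<open>x\<close> off
      \<open>I\<close>; with that settled, the indicator of the box factorises.\<close>
    then have "x \<in> extensional I" by (auto simp: space_PiM PiE_def)
    then have "indicator (Pi\<^sub>E I A) x = (\<Prod>j\<in>I. indicator (A j) (x j) :: ennreal)"
      using I by (auto simp: indicator_def PiE_def Pi_def prod_zero)
    then show "(\<Prod>j\<in>I. ennreal (gauss_dens \<theta> (x j))) * indicator (Pi\<^sub>E I A) x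
      = (\<Prod>j\<in>I. ennreal (gauss_dens \<theta> (x j)) * indicator (A j) (x j))"
      by (simp add: prod.distrib)
  qed
  also have "\<dots> = (\<Prod>j\<in>I. \<integral>\<^sup>+t. ennreal (gauss_dens \<theta> t) * indicator (A j) t \<partial>lborel)"
    using I by (intro L.product_nn_integral_prod) auto
  also have "\<dots> = (\<Prod>j\<in>I. emeasure (gaussian (matrix_inv \<theta>)) (A j))"
    unfolding gaussian_matrix_inv_eq_density[OF \<theta>]
    by (intro prod.cong refl) (simp add: emeasure_density)
  finally show "emeasure (density (Pi\<^sub>M I (\<lambda>_. lborel)) (\<lambda>x. \<Prod>j\<in>I. ennreal (gauss_dens \<theta> (x j)))) (Pi\<^sub>E I A)
      = (\<Prod>j\<in>I. emeasure (gaussian (matrix_inv \<theta>)) (A j))" .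
qed (fact I)

context stoch_prox_process
begin

lemma sets_history: "sets (history M \<theta> n) = sigma_sets (space M) {\<theta> i -` A \<inter> space M | i A. i \<le> n \<and> A \<in> sets borel}"
  unfolding history_def by (rule sets_measure_of) auto

lemma space_history: "space (history M \<theta> n) = space M"
  unfolding history_def by (rule space_measure_of) auto

lemma vimage_in_history: "i \<le> n \<Longrightarrow> A \<in> sets borel \<Longrightarrow> \<theta> i -` A \<inter> space M \<in> sets (history M \<theta> n)"
  unfolding sets_history by (rule sigma_sets.Basic) auto

lemma subalgebra_history: "subalgebra M (history M \<theta> n)"
  unfolding subalgebra_def space_history sets_history
  using measurable_sets[OF \<theta>_measurable] by (auto intro!: sets.sigma_sets_subset)

lemma sets_draws_rectangle:
  assumes k: "1 \<le> k" and B: "\<And>j. j \<in> {1..N k} \<Longrightarrow> B j \<in> sets borel"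
  shows "{\<omega> \<in> space M. \<forall>j\<in>{1..N k}. z k j \<omega> \<in> B j} \<in> sets M"
proof -
  \<comment> \<open>A nonempty index set is required to write the event as an intersection of
    preimages inside \<open>space M\<close>.\<close>
  have "1 \<in> {1..N k}" using N_pos[OF k] by simp
  then have "{\<omega> \<in> space M. \<forall>j\<in>{1..N k}. z k j \<omega> \<in> B j} = (\<Inter>j\<in>{1..N k}. z k j -` B j \<inter> space M)"
    by blast
  also have "\<dots> \<in> sets M"
    using \<open>1 \<in> {1..N k}\<close> B z_measurable[OF k]
    by (intro sets.finite_INT) (auto intro: measurable_sets)
  finally show ?thesis .
qed

text \<open>Integrates the conditional probability over an event \<open>D\<close> of the past. On
  \<open>D\<close> all past iterates are positive definite, exactly where the conditional law is
  prescribed.\<close>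

lemma prob_draws_rectangle:
  assumes D: "D \<in> sets (history M \<theta> n)" "\<And>\<omega>. \<omega> \<in> D \<Longrightarrow> \<forall>i\<le>n. \<theta> i \<omega> \<in> pd_mats"
    and B: "\<And>j. j \<in> {1..N (Suc n)} \<Longrightarrow> B j \<in> sets borel"
  shows "emeasure M {\<omega> \<in> D. \<forall>j\<in>{1..N (Suc n)}. z (Suc n) j \<omega> \<in> B j}
    = (\<integral>\<^sup>+\<omega>. indicator D \<omega> * (\<Prod>j=1..N (Suc n). emeasure (gaussian (matrix_inv (\<theta> n \<omega>))) (B j)) \<partial>M)"
proof -
  define F where "F = history M \<theta> n"
  interpret finite_measure_subalgebra M F
    unfolding F_def by unfold_locales (rule subalgebra_history)
  have DF: "D \<in> sets F" using D by (simp add: F_def)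
  then have DM [measurable]: "D \<in> sets M" using subalg by (auto simp: subalgebra_def)
  define C where "C = {\<omega> \<in> space M. \<forall>j\<in>{1..N (Suc n)}. z (Suc n) j \<omega> \<in> B j}"
  have CM [measurable]: "C \<in> sets M"
    unfolding C_def by (rule sets_draws_rectangle) (use B in auto)
  have intC: "integrable M (indicat_real C)" by (simp add: integrable_real_indicator emeasure_eq_measure)
  let ?r = "real_cond_exp M F (indicat_real C)"
  have int: "integrable M (\<lambda>\<omega>. indicat_real D \<omega> * ?r \<omega>)"
    using integrable_mult_indicator[OF DM real_cond_exp_int(1)[OF intC]] by simp
  have "AE \<omega> in M. (\<forall>i<Suc n. \<theta> i \<omega> \<in> pd_mats) \<longrightarrow>
      ?r \<omega> = (\<Prod>j = 1..N (Suc n). measure (gaussian (matrix_inv (\<theta> n \<omega>))) (B j))"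
    using draws[of "Suc n" B] B by (simp add: F_def C_def)
  then have r: "AE \<omega> in M. \<omega> \<in> D \<longrightarrow> ?r \<omega> = (\<Prod>j = 1..N (Suc n). measure (gaussian (matrix_inv (\<theta> n \<omega>))) (B j))"
    by eventually_elim (use D(2) in \<open>auto simp: less_Suc_eq_le\<close>)
  have "{\<omega> \<in> D. \<forall>j\<in>{1..N (Suc n)}. z (Suc n) j \<omega> \<in> B j} = D \<inter> C"
    using sets.sets_into_space[OF DM] by (auto simp: C_def)
  then have "emeasure M {\<omega> \<in> D. \<forall>j\<in>{1..N (Suc n)}. z (Suc n) j \<omega> \<in> B j} = ennreal (\<integral>\<omega>. indicat_real (D \<inter> C) \<omega> \<partial>M)"
    by (simp add: emeasure_eq_measure)
  also have "(\<integral>\<omega>. indicat_real (D \<inter> C) \<omega> \<partial>M) = (\<integral>\<omega>\<in>D. indicat_real C \<omega> \<partial>M)"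
    by (simp add: set_lebesgue_integral_def indicator_inter_arith)
  also have "\<dots> = (\<integral>\<omega>\<in>D. ?r \<omega> \<partial>M)" by (rule real_cond_exp_intA[OF intC DF])
  also have "\<dots> = (\<integral>\<omega>. indicat_real D \<omega> * ?r \<omega> \<partial>M)" by (simp add: set_lebesgue_integral_def)
  also have "ennreal \<dots> = (\<integral>\<^sup>+\<omega>. ennreal (indicat_real D \<omega> * ?r \<omega>) \<partial>M)"
  proof (rule nn_integral_eq_integral[OF int, symmetric])
    \<comment> \<open>Nonnegativity on \<open>D\<close> is read off from the product formula; off
      \<open>D\<close> the integrand is zero.\<close>
    show "AE \<omega> in M. 0 \<le> indicat_real D \<omega> * ?r \<omega>"
      using r by eventually_elim (auto simp: indicator_def intro!: prod_nonneg)
  qed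
  also have "\<dots> = (\<integral>\<^sup>+\<omega>. indicator D \<omega> * (\<Prod>j=1..N (Suc n). emeasure (gaussian (matrix_inv (\<theta> n \<omega>))) (B j)) \<partial>M)"
  proof (rule nn_integral_cong_AE)
    show "AE \<omega> in M. ennreal (indicat_real D \<omega> * ?r \<omega>)
        = indicator D \<omega> * (\<Prod>j=1..N (Suc n). emeasure (gaussian (matrix_inv (\<theta> n \<omega>))) (B j))"
      using r
    proof eventually_elim
      case (elim \<omega>)
      show ?case
      proof (cases "\<omega> \<in> D")
        case True
        then have "prob_space (gaussian (matrix_inv (\<theta> n \<omega>)))"
          using D(2) by (intro prob_space_gaussian) auto
        then interpret G: prob_space "gaussian (matrix_inv (\<theta> n \<omega>))" .
        show ?thesis using True elim by (simp add: G.emeasure_eq_measure prod_ennreal)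
      qed simp
    qed
  qed
  finally show ?thesis .
qed

text \<open>Both sides integrate \<open>\<Phi>\<close> over pairs of state and draws: one against
  the actual joint law on \<open>D\<close>, the other against the law of the state followed by the
  Gaussian kernel. The two measures agree on boxes, hence everywhere.\<close>

lemma nn_integral_conditional_draws:
  assumes D: "D \<in> sets (history M \<theta> n)" "\<And>\<omega>. \<omega> \<in> D \<Longrightarrow> \<forall>i\<le>n. \<theta> i \<omega> \<in> pd_mats"
    and \<Phi>: "\<Phi> \<in> borel_measurable (borel \<Otimes>\<^sub>M Pi\<^sub>M {1..N (Suc n)} (\<lambda>_. borel))"
  shows "(\<integral>\<^sup>+\<omega>. indicator D \<omega> * \<Phi> (\<theta> n \<omega>, \<lambda>j\<in>{1..N (Suc n)}. z (Suc n) j \<omega>) \<partial>M)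
    = (\<integral>\<^sup>+\<omega>. indicator D \<omega> * (\<integral>\<^sup>+x. \<Phi> (\<theta> n \<omega>, x) \<partial>Pi\<^sub>M {1..N (Suc n)} (\<lambda>_. gaussian (matrix_inv (\<theta> n \<omega>)))) \<partial>M)"
proof -
  define I where "I = {1..N (Suc n)}"
  define Z where "Z \<omega> = (\<lambda>j\<in>I. z (Suc n) j \<omega>)" for \<omega>
  have I: "finite I" by (simp add: I_def)
  have DM [measurable]: "D \<in> sets M" using D subalgebra_history[of n] by (auto simp: subalgebra_def)
  have [measurable]: "Z \<in> measurable M (Pi\<^sub>M I (\<lambda>_. borel))"
    unfolding Z_def by (rule measurable_restrict) (use z_measurable in \<open>auto simp: I_def\<close>)
  note \<theta>_measurable [measurable]
  define m1 where "m1 = distr (density M (indicator D)) (borel \<Otimes>\<^sub>M Pi\<^sub>M I (\<lambda>_. borel)) (\<lambda>\<omega>. (\<theta> n \<omega>, Z \<omega>))"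
  define q where "q p = (\<Prod>j\<in>I. ennreal (gauss_dens (fst p) (snd p j)))" for p :: "(real^'p^'p) \<times> (nat \<Rightarrow> real^'p)"
  define m2 where "m2 = density (distr (density M (indicator D)) borel (\<theta> n) \<Otimes>\<^sub>M Pi\<^sub>M I (\<lambda>_. lborel)) q"
  interpret L: product_sigma_finite "\<lambda>_. lborel :: (real^'p) measure" ..
  interpret LI: sigma_finite_measure "Pi\<^sub>M I (\<lambda>_. lborel :: (real^'p) measure)"
    by (rule L.sigma_finite[OF I])
  have sL: "sets (Pi\<^sub>M I (\<lambda>_. lborel :: (real^'p) measure)) = sets (Pi\<^sub>M I (\<lambda>_. borel))"
    by (rule sets_PiM_cong) auto
  have q [measurable]: "q \<in> borel_measurable (borel \<Otimes>\<^sub>M Pi\<^sub>M I (\<lambda>_. borel))"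
  proof -
    have "(\<lambda>p. gauss_dens (fst p) (snd p j)) \<in> borel_measurable (borel \<Otimes>\<^sub>M Pi\<^sub>M I (\<lambda>_. borel :: (real^'p) measure))" if "j \<in> I" for j
    proof -
      have "(\<lambda>p. (fst p, snd p j)) \<in> measurable (borel \<Otimes>\<^sub>M Pi\<^sub>M I (\<lambda>_. borel :: (real^'p) measure)) (borel \<Otimes>\<^sub>M borel)"
        using that by measurable
      from measurable_compose[OF this measurable_gauss_dens] show ?thesis by simp
    qed
    then show ?thesis unfolding q_def by measurable
  qed
  have sets_m: "sets (distr (density M (indicator D)) borel (\<theta> n) \<Otimes>\<^sub>M Pi\<^sub>M I (\<lambda>_. lborel :: (real^'p) measure))
      = sets (borel \<Otimes>\<^sub>M Pi\<^sub>M I (\<lambda>_. borel))"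
    by (intro sets_pair_measure_cong sL) simp
  have int1: "(\<integral>\<^sup>+p. \<Psi> p \<partial>m1) = (\<integral>\<^sup>+\<omega>. indicator D \<omega> * \<Psi> (\<theta> n \<omega>, Z \<omega>) \<partial>M)"
    if [measurable]: "\<Psi> \<in> borel_measurable (borel \<Otimes>\<^sub>M Pi\<^sub>M I (\<lambda>_. borel))" for \<Psi>
    unfolding m1_def by (simp add: nn_integral_distr nn_integral_density)
  \<comment> \<open>Used twice: for indicators of boxes to identify \<open>m1\<close> with
    \<open>m2\<close>, and for \<open>\<Phi>\<close> itself at the end.\<close>
  have int2: "(\<integral>\<^sup>+p. \<Psi> p \<partial>m2) = (\<integral>\<^sup>+\<omega>. indicator D \<omega> * (\<integral>\<^sup>+x. \<Psi> (\<theta> n \<omega>, x) \<partial>Pi\<^sub>M I (\<lambda>_. gaussian (matrix_inv (\<theta> n \<omega>)))) \<partial>M)"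
    if \<Psi> [measurable]: "\<Psi> \<in> borel_measurable (borel \<Otimes>\<^sub>M Pi\<^sub>M I (\<lambda>_. borel))" for \<Psi>
  proof -
    have q\<Psi>: "(\<lambda>p. q p * \<Psi> p) \<in> borel_measurable (distr (density M (indicator D)) borel (\<theta> n) \<Otimes>\<^sub>M Pi\<^sub>M I (\<lambda>_. lborel))"
      "(\<lambda>p. q p * \<Psi> p) \<in> borel_measurable (borel \<Otimes>\<^sub>M Pi\<^sub>M I (\<lambda>_. lborel))"
      using sL by (auto simp: measurable_cong_sets[OF sets_m refl] measurable_cong_sets[OF sets_pair_measure_cong[OF refl sL] refl])
    have "(\<integral>\<^sup>+p. \<Psi> p \<partial>m2) = (\<integral>\<^sup>+p. q p * \<Psi> p \<partial>(distr (density M (indicator D)) borel (\<theta> n) \<Otimes>\<^sub>M Pi\<^sub>M I (\<lambda>_. lborel)))"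
      unfolding m2_def
      by (rule nn_integral_density) (simp_all add: measurable_cong_sets[OF sets_m refl])
    also have "\<dots> = (\<integral>\<^sup>+t. \<integral>\<^sup>+x. q (t, x) * \<Psi> (t, x) \<partial>Pi\<^sub>M I (\<lambda>_. lborel) \<partial>distr (density M (indicator D)) borel (\<theta> n))"
      by (rule LI.nn_integral_fst[symmetric, OF q\<Psi>(1)])
    also have "\<dots> = (\<integral>\<^sup>+\<omega>. indicator D \<omega> * (\<integral>\<^sup>+x. q (\<theta> n \<omega>, x) * \<Psi> (\<theta> n \<omega>, x) \<partial>Pi\<^sub>M I (\<lambda>_. lborel)) \<partial>M)"
      using LI.borel_measurable_nn_integral_fst[OF q\<Psi>(2)]
      by (simp add: nn_integral_distr nn_integral_density)
    also have "\<dots> = (\<integral>\<^sup>+\<omega>. indicator D \<omega> * (\<integral>\<^sup>+x. \<Psi> (\<theta> n \<omega>, x) \<partial>Pi\<^sub>M I (\<lambda>_. gaussian (matrix_inv (\<theta> n \<omega>)))) \<partial>M)"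
    proof (rule nn_integral_cong)
      fix \<omega> assume "\<omega> \<in> space M"
      show "indicator D \<omega> * (\<integral>\<^sup>+x. q (\<theta> n \<omega>, x) * \<Psi> (\<theta> n \<omega>, x) \<partial>Pi\<^sub>M I (\<lambda>_. lborel))
          = indicator D \<omega> * (\<integral>\<^sup>+x. \<Psi> (\<theta> n \<omega>, x) \<partial>Pi\<^sub>M I (\<lambda>_. gaussian (matrix_inv (\<theta> n \<omega>))))"
      proof (cases "\<omega> \<in> D")
        case True
        then have pd: "\<theta> n \<omega> \<in> pd_mats" using D(2) by auto
        have "(\<lambda>x. q (\<theta> n \<omega>, x)) \<in> borel_measurable (Pi\<^sub>M I (\<lambda>_. lborel))"
          "(\<lambda>x. \<Psi> (\<theta> n \<omega>, x)) \<in> borel_measurable (Pi\<^sub>M I (\<lambda>_. lborel))"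
          unfolding measurable_cong_sets[OF sL refl] by measurable
        then show ?thesis
          unfolding PiM_gaussian_eq_density[OF pd I] by (subst nn_integral_density) (simp_all add: q_def)
      qed simp
    qed
    finally show ?thesis .
  qed
  have "m1 = m2"
  proof (rule measure_eqI_pair_PiM[OF I])
    show "sets m1 = sets (borel \<Otimes>\<^sub>M Pi\<^sub>M I (\<lambda>_. borel))" by (simp add: m1_def)
    show sm2: "sets m2 = sets (borel \<Otimes>\<^sub>M Pi\<^sub>M I (\<lambda>_. borel))"
      unfolding m2_def sets_density by (rule sets_m)
    have "emeasure m1 (space m1) = emeasure M D"
      using int1[of "\<lambda>_. 1"] by simp
    then show "emeasure m1 (space m1) \<noteq> \<infinity>" by simp
    fix A :: "(real^'p^'p) set" and B :: "nat \<Rightarrow> (real^'p) set"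
    assume A: "A \<in> sets borel" and B: "\<And>i. i \<in> I \<Longrightarrow> B i \<in> sets borel"
    let ?X = "A \<times> Pi\<^sub>E I B"
    have X: "?X \<in> sets (borel \<Otimes>\<^sub>M Pi\<^sub>M I (\<lambda>_. borel))"
      using A B I by (intro pair_measureI sets_PiM_I_finite) auto
    \<comment> \<open>The constraint on the current state is itself an event of the past; absorbing
      it leaves only a rectangle of draws.\<close>
    define D' where "D' = D \<inter> (\<theta> n -` A \<inter> space M)"
    have D': "D' \<in> sets (history M \<theta> n)"
      unfolding D'_def using D(1) A by (intro sets.Int vimage_in_history) auto
    have D'sp: "\<omega> \<in> D' \<longleftrightarrow> \<omega> \<in> D \<and> \<theta> n \<omega> \<in> A" if "\<omega> \<in> space M" for \<omega>
      using that by (auto simp: D'_def)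
    have Dsp: "D' \<subseteq> space M" by (auto simp: D'_def)
    have "emeasure m1 ?X = (\<integral>\<^sup>+\<omega>. indicator D \<omega> * indicator ?X (\<theta> n \<omega>, Z \<omega>) \<partial>M)"
      using int1[of "indicator ?X"] X by (simp add: m1_def)
    also have "\<dots> = (\<integral>\<^sup>+\<omega>. indicator {\<omega> \<in> D'. \<forall>j\<in>I. z (Suc n) j \<omega> \<in> B j} \<omega> \<partial>M)"
      by (intro nn_integral_cong) (auto simp: indicator_def D'sp Z_def PiE_iff)
    also have "\<dots> = emeasure M {\<omega> \<in> D'. \<forall>j\<in>I. z (Suc n) j \<omega> \<in> B j}"
    proof (rule nn_integral_indicator)
      have "D' \<in> sets M" using D' subalgebra_history[of n] by (auto simp: subalgebra_def)
      moreover have "{\<omega> \<in> space M. \<forall>j\<in>I. z (Suc n) j \<omega> \<in> B j} \<in> sets M"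
        unfolding I_def by (rule sets_draws_rectangle) (use B in \<open>auto simp: I_def\<close>)
      moreover have "{\<omega> \<in> D'. \<forall>j\<in>I. z (Suc n) j \<omega> \<in> B j} = D' \<inter> {\<omega> \<in> space M. \<forall>j\<in>I. z (Suc n) j \<omega> \<in> B j}"
        using Dsp by auto
      ultimately show "{\<omega> \<in> D'. \<forall>j\<in>I. z (Suc n) j \<omega> \<in> B j} \<in> sets M" by simp
    qed
    also have "\<dots> = (\<integral>\<^sup>+\<omega>. indicator D' \<omega> * (\<Prod>j\<in>I. emeasure (gaussian (matrix_inv (\<theta> n \<omega>))) (B j)) \<partial>M)"
      unfolding I_def by (rule prob_draws_rectangle[OF D']) (use D(2) B in \<open>auto simp: D'_def I_def\<close>)
    also have "\<dots> = (\<integral>\<^sup>+\<omega>. indicator D \<omega> * (\<integral>\<^sup>+x. indicator ?X (\<theta> n \<omega>, x) \<partial>Pi\<^sub>M I (\<lambda>_. gaussian (matrix_inv (\<theta> n \<omega>)))) \<partial>M)"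
    proof (rule nn_integral_cong)
      fix \<omega> assume \<omega>: "\<omega> \<in> space M"
      show "indicator D' \<omega> * (\<Prod>j\<in>I. emeasure (gaussian (matrix_inv (\<theta> n \<omega>))) (B j))
          = indicator D \<omega> * (\<integral>\<^sup>+x. indicator ?X (\<theta> n \<omega>, x) \<partial>Pi\<^sub>M I (\<lambda>_. gaussian (matrix_inv (\<theta> n \<omega>))))"
      proof (cases "\<omega> \<in> D")
        case True
        then interpret G: prob_space "gaussian (matrix_inv (\<theta> n \<omega>))"
          using D(2) by (intro prob_space_gaussian) auto
        interpret PG: product_sigma_finite "\<lambda>_. gaussian (matrix_inv (\<theta> n \<omega>))" ..
        have "Pi\<^sub>E I B \<in> sets (Pi\<^sub>M I (\<lambda>_. gaussian (matrix_inv (\<theta> n \<omega>))))"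
          using B I by (intro sets_PiM_I_finite) auto
        then have "(\<integral>\<^sup>+x. indicator ?X (\<theta> n \<omega>, x) \<partial>Pi\<^sub>M I (\<lambda>_. gaussian (matrix_inv (\<theta> n \<omega>))))
            = indicator A (\<theta> n \<omega>) * emeasure (Pi\<^sub>M I (\<lambda>_. gaussian (matrix_inv (\<theta> n \<omega>)))) (Pi\<^sub>E I B)"
          by (simp add: indicator_times nn_integral_cmult)
        also have "emeasure (Pi\<^sub>M I (\<lambda>_. gaussian (matrix_inv (\<theta> n \<omega>)))) (Pi\<^sub>E I B)
            = (\<Prod>j\<in>I. emeasure (gaussian (matrix_inv (\<theta> n \<omega>))) (B j))"
          using B by (intro PG.emeasure_PiM I) auto
        finally show ?thesis
          using True D'sp[OF \<omega>] by (auto simp: indicator_def)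
      qed (use D'sp[OF \<omega>] in simp)
    qed
    also have "\<dots> = emeasure m2 ?X"
      using int2[of "indicator ?X"] X nn_integral_indicator[of ?X m2] unfolding sm2 by simp
    finally show "emeasure m1 ?X = emeasure m2 ?X" .
  qed
  then have "(\<integral>\<^sup>+p. \<Phi> p \<partial>m1) = (\<integral>\<^sup>+p. \<Phi> p \<partial>m2)" by simp
  then show ?thesis
    using int1[of \<Phi>] int2[of \<Phi>] \<Phi> by (simp add: I_def Z_def)
qed

end

section \<open>The recursive error bound\<close>

lemma exit_time_gt_iff: "enat k < exit_time \<theta> l \<psi> \<omega> \<longleftrightarrow> (\<forall>i\<le>k. \<theta> i \<omega> \<in> pd_mats_between l \<psi>)"
proof
  assume gt: "enat k < exit_time \<theta> l \<psi> \<omega>"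
  show "\<forall>i\<le>k. \<theta> i \<omega> \<in> pd_mats_between l \<psi>"
  proof (rule ccontr)
    assume "\<not> (\<forall>i\<le>k. \<theta> i \<omega> \<in> pd_mats_between l \<psi>)"
    then obtain i where i: "i \<le> k" "\<theta> i \<omega> \<notin> pd_mats_between l \<psi>" by auto
    then have "exit_time \<theta> l \<psi> \<omega> \<le> enat i" unfolding exit_time_def by (intro INF_lower) simp
    with i gt show False by (meson enat_ord_simps(1) leD order_trans)
  qed
next
  assume "\<forall>i\<le>k. \<theta> i \<omega> \<in> pd_mats_between l \<psi>"
  \<comment> \<open>Strictness becomes a lower bound by \<open>Suc k\<close> on all exit indices,
    which also covers a chain that never exits.\<close>
  then have "enat (Suc k) \<le> exit_time \<theta> l \<psi> \<omega>"
    unfolding exit_time_def by (intro INF_greatest) (auto simp: not_le Suc_le_eq intro: ccontr)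
  then show "enat k < exit_time \<theta> l \<psi> \<omega>" by (simp add: Suc_ile_eq)
qed

text \<open>The deterministic contraction and the variance bound are combined for a frozen state and
  then integrated over the event \<open>D\<close> of survival through step \<open>n\<close>.\<close>

lemma (in stoch_prox_process) error_recursion:
  assumes "0 \<le> lam" "0 \<le> \<alpha>" "\<alpha> \<le> 1" "0 < \<gamma>" "0 < l" "ereal l \<le> \<psi>" "\<gamma> \<le> l\<^sup>2"
    and mn: "is_arg_min (objective S lam \<alpha>) (\<lambda>\<theta>. \<theta> \<in> pd_mats) \<theta>hat"
    and \<theta>hat: "\<theta>hat \<in> pd_mats_between l \<psi>"
  defines "err \<equiv> \<lambda>k. \<integral>\<^sup>+\<omega>. ennreal (indicator {\<omega>. exit_time \<theta> l \<psi> \<omega> > enat k} \<omega>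
      * (frob_norm (\<theta> k \<omega> - \<theta>hat))\<^sup>2) \<partial>M"
  shows "err (Suc n) \<le> ennreal (contraction \<gamma> \<psi>) * err n
    + ennreal (2 * \<gamma>\<^sup>2 * (1 / l\<^sup>2) * (real CARD('p) + (real CARD('p))\<^sup>2) * (1 / real (N (Suc n))))"
proof -
  define e where "e = 2 * \<gamma>\<^sup>2 * (1 / l\<^sup>2) * (real CARD('p) + (real CARD('p))\<^sup>2) * (1 / real (N (Suc n)))"
  define c where "c = contraction \<gamma> \<psi>"
  have c: "0 \<le> c" using contraction_factor_bounds(1)[OF assms(5,6,4,7)] by (simp add: c_def)
  have e: "0 \<le> e" by (simp add: e_def)
  define D where "D = {\<omega> \<in> space M. \<forall>i\<le>n. \<theta> i \<omega> \<in> pd_mats_between l \<psi>}"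
  have "D = (\<Inter>i\<in>{..n}. \<theta> i -` pd_mats_between l \<psi> \<inter> space M)" by (auto simp: D_def)
  also have "\<dots> \<in> sets (history M \<theta> n)"
    using closed_pd_mats_between[OF \<open>0 < l\<close>]
    by (intro sets.finite_INT vimage_in_history borel_closed) auto
  finally have DH: "D \<in> sets (history M \<theta> n)" .
  then have [measurable]: "D \<in> sets M" using subalgebra_history[of n] by (auto simp: subalgebra_def)
  have Dpd: "\<forall>i\<le>n. \<theta> i \<omega> \<in> pd_mats" if "\<omega> \<in> D" for \<omega>
    using that by (auto simp: D_def pd_mats_between_def)
  note \<theta>_measurable [measurable]
  define \<Phi> where "\<Phi> p = ennreal ((norm (fst p - \<theta>hat + \<gamma> *\<^sub>R (sample_cov (N (Suc n)) (snd p) - matrix_inv \<theta>hat)))\<^sup>2)"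
    for p :: "(real^'p^'p) \<times> (nat \<Rightarrow> real^'p)"
  have \<Phi>: "\<Phi> \<in> borel_measurable (borel \<Otimes>\<^sub>M Pi\<^sub>M {1..N (Suc n)} (\<lambda>_. borel))"
  proof -
    have "(\<lambda>p. sample_cov (N (Suc n)) (snd p)) \<in> borel_measurable (borel \<Otimes>\<^sub>M Pi\<^sub>M {1..N (Suc n)} (\<lambda>_. borel))"
      unfolding sample_cov_def by measurable
    then show ?thesis unfolding \<Phi>_def by measurable
  qed
  have "err (Suc n) \<le> (\<integral>\<^sup>+\<omega>. indicator D \<omega> * \<Phi> (\<theta> n \<omega>, \<lambda>j\<in>{1..N (Suc n)}. z (Suc n) j \<omega>) \<partial>M)"
    unfolding err_def
  proof (rule nn_integral_mono)
    fix \<omega> assume \<omega>: "\<omega> \<in> space M"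
    show "ennreal (indicator {\<omega>. exit_time \<theta> l \<psi> \<omega> > enat (Suc n)} \<omega> * (frob_norm (\<theta> (Suc n) \<omega> - \<theta>hat))\<^sup>2)
      \<le> indicator D \<omega> * \<Phi> (\<theta> n \<omega>, \<lambda>j\<in>{1..N (Suc n)}. z (Suc n) j \<omega>)"
    proof (cases "exit_time \<theta> l \<psi> \<omega> > enat (Suc n)")
      case True
      then have D: "\<omega> \<in> D" using \<omega> by (simp add: exit_time_gt_iff D_def)
      let ?\<Sigma> = "sample_cov (N (Suc n)) (\<lambda>j. z (Suc n) j \<omega>)"
      have "\<theta> (Suc n) \<omega> = prox \<gamma> lam \<alpha> (\<theta> n \<omega> - \<gamma> *\<^sub>R (S - ?\<Sigma>))"
        using recursion[of "Suc n" \<omega>] \<omega> Dpd[OF D] by (simp add: less_Suc_eq_le)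
      then have "norm (\<theta> (Suc n) \<omega> - \<theta>hat)
          \<le> norm (\<theta> n \<omega> - \<gamma> *\<^sub>R (S - ?\<Sigma>) - (\<theta>hat - \<gamma> *\<^sub>R (S - matrix_inv \<theta>hat)))"
        using prox_step_nonexpansive[OF assms(1-4) mn] by simp
      also have "\<theta> n \<omega> - \<gamma> *\<^sub>R (S - ?\<Sigma>) - (\<theta>hat - \<gamma> *\<^sub>R (S - matrix_inv \<theta>hat))
          = \<theta> n \<omega> - \<theta>hat + \<gamma> *\<^sub>R (?\<Sigma> - matrix_inv \<theta>hat)"
        by (simp add: algebra_simps)
      \<comment> \<open>The sample covariance reads only the indices from 1 to the sample size, so
        the restriction required by the product space changes nothing.\<close>
      also have "?\<Sigma> = sample_cov (N (Suc n)) (\<lambda>j\<in>{1..N (Suc n)}. z (Suc n) j \<omega>)"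
        by (simp add: sample_cov_def)
      finally have "(norm (\<theta> (Suc n) \<omega> - \<theta>hat))\<^sup>2 \<le> (norm (\<theta> n \<omega> - \<theta>hat
          + \<gamma> *\<^sub>R (sample_cov (N (Suc n)) (\<lambda>j\<in>{1..N (Suc n)}. z (Suc n) j \<omega>) - matrix_inv \<theta>hat)))\<^sup>2"
        by (rule power_mono) simp
      then show ?thesis
        using D by (simp add: \<Phi>_def frob_norm_eq_norm indicator_def ennreal_leI)
    qed simp
  qed
  also have "\<dots> = (\<integral>\<^sup>+\<omega>. indicator D \<omega> * (\<integral>\<^sup>+x. \<Phi> (\<theta> n \<omega>, x)
      \<partial>Pi\<^sub>M {1..N (Suc n)} (\<lambda>_. gaussian (matrix_inv (\<theta> n \<omega>)))) \<partial>M)"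
    by (rule nn_integral_conditional_draws[OF DH Dpd \<Phi>])
  \<comment> \<open>The noise term is charged on the whole space and not just on \<open>D\<close>:
    the survival probability is bounded by one.\<close>
  also have "\<dots> \<le> (\<integral>\<^sup>+\<omega>. ennreal c * ennreal (indicator D \<omega> * (norm (\<theta> n \<omega> - \<theta>hat))\<^sup>2) + ennreal e \<partial>M)"
  proof (rule nn_integral_mono)
    fix \<omega> assume \<omega>: "\<omega> \<in> space M"
    show "indicator D \<omega> * (\<integral>\<^sup>+x. \<Phi> (\<theta> n \<omega>, x) \<partial>Pi\<^sub>M {1..N (Suc n)} (\<lambda>_. gaussian (matrix_inv (\<theta> n \<omega>))))
      \<le> ennreal c * ennreal (indicator D \<omega> * (norm (\<theta> n \<omega> - \<theta>hat))\<^sup>2) + ennreal e"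
    proof (cases "\<omega> \<in> D")
      case True
      define t where "t = \<theta> n \<omega>"
      have t: "t \<in> pd_mats_between l \<psi>" using True by (simp add: D_def t_def)
      define Y where "Y = (t - \<theta>hat) + \<gamma> *\<^sub>R (matrix_inv t - matrix_inv \<theta>hat)"
      have "\<Phi> (t, x) = ennreal ((norm (Y + \<gamma> *\<^sub>R (sample_cov (N (Suc n)) x - matrix_inv t)))\<^sup>2)" for x
        by (simp add: \<Phi>_def Y_def algebra_simps)
      then have "(\<integral>\<^sup>+x. \<Phi> (t, x) \<partial>Pi\<^sub>M {1..N (Suc n)} (\<lambda>_. gaussian (matrix_inv t)))
          \<le> ennreal ((norm Y)\<^sup>2 + e)"
        unfolding e_def
        using nn_integral_sample_cov_step[OF \<open>0 < l\<close> t, of "N (Suc n)" Y \<gamma>] N_pos[of "Suc n"] by simp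
      also have "\<dots> \<le> ennreal (c * (norm (t - \<theta>hat))\<^sup>2 + e)"
        using gradient_step_contraction[OF assms(5,6,4,7) t \<theta>hat]
        by (intro ennreal_leI) (simp add: Y_def c_def)
      also have "\<dots> = ennreal c * ennreal ((norm (t - \<theta>hat))\<^sup>2) + ennreal e"
        using c e by (simp add: ennreal_mult)
      finally show ?thesis using True by (simp add: t_def)
    qed simp
  qed
  also have "\<dots> = ennreal c * (\<integral>\<^sup>+\<omega>. ennreal (indicator D \<omega> * (norm (\<theta> n \<omega> - \<theta>hat))\<^sup>2) \<partial>M) + ennreal e"
    by (simp add: nn_integral_add nn_integral_cmult emeasure_space_1)
  also have "(\<integral>\<^sup>+\<omega>. ennreal (indicator D \<omega> * (norm (\<theta> n \<omega> - \<theta>hat))\<^sup>2) \<partial>M) = err n"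
    unfolding err_def
    by (rule nn_integral_cong) (simp add: indicator_def D_def exit_time_gt_iff frob_norm_eq_norm)
  finally show ?thesis by (simp add: c_def e_def)
qed

theorem theorem7:
  fixes M :: "'a measure"
    and S \<theta>0 \<theta>hat :: "real^'p^'p"
    and lam \<alpha> \<gamma> l :: real and \<psi> :: ereal
    and N :: "nat \<Rightarrow> nat"
    and \<theta> :: "nat \<Rightarrow> 'a \<Rightarrow> real^'p^'p"
    and z :: "nat \<Rightarrow> nat \<Rightarrow> 'a \<Rightarrow> real^'p"
  assumes "S \<in> psd_mats" and "0 < lam" and "0 < \<alpha>" and "\<alpha> \<le> 1" and "0 < \<gamma>"
    and "stoch_prox_process M S lam \<alpha> \<gamma> N \<theta>0 \<theta> z"
    and "is_arg_min (objective S lam \<alpha>) (\<lambda>\<theta>. \<theta> \<in> pd_mats) \<theta>hat"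
    and "0 < l" and "ereal l \<le> \<psi>"
    and "\<theta>0 \<in> pd_mats_between l \<psi>" and "\<theta>hat \<in> pd_mats_between l \<psi>"
    and "\<gamma> \<le> l\<^sup>2"
  shows "\<forall>k\<ge>1.
    (\<integral>\<^sup>+\<omega>. ennreal (indicator {\<omega>. exit_time \<theta> l \<psi> \<omega> > enat k} \<omega>
                  * (frob_norm (\<theta> k \<omega> - \<theta>hat))\<^sup>2) \<partial>M)
    \<le> ennreal (contraction \<gamma> \<psi> ^ k * (frob_norm (\<theta>0 - \<theta>hat))\<^sup>2
        + 2 * \<gamma>\<^sup>2 * (1 / l\<^sup>2) * (real CARD('p) + (real CARD('p))\<^sup>2)
            * (\<Sum>j = 1..k. 1 / real (N j) * contraction \<gamma> \<psi> ^ (k - j)))"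
proof -
  interpret stoch_prox_process M S lam \<alpha> \<gamma> N \<theta>0 \<theta> z by fact
  define c where "c = contraction \<gamma> \<psi>"
  define K where "K = 2 * \<gamma>\<^sup>2 * (1 / l\<^sup>2) * (real CARD('p) + (real CARD('p))\<^sup>2)"
  define d where "d = (frob_norm (\<theta>0 - \<theta>hat))\<^sup>2"
  define err where "err k = (\<integral>\<^sup>+\<omega>. ennreal (indicator {\<omega>. exit_time \<theta> l \<psi> \<omega> > enat k} \<omega>
                  * (frob_norm (\<theta> k \<omega> - \<theta>hat))\<^sup>2) \<partial>M)" for k
  have c: "0 \<le> c" using contraction_factor_bounds(1)[of l \<psi> \<gamma>] assms by (simp add: c_def)
  have K: "0 \<le> K" and d: "0 \<le> d" by (auto simp: K_def d_def)
  \<comment> \<open>The induction starts at 0, where the sum is empty and the deterministic initial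
    error is the whole bound.\<close>
  have "err k \<le> ennreal (c ^ k * d + K * (\<Sum>j = 1..k. 1 / real (N j) * c ^ (k - j)))" for k
  proof (induction k)
    case 0
    have "err 0 \<le> (\<integral>\<^sup>+\<omega>. ennreal d \<partial>M)"
      unfolding err_def by (intro nn_integral_mono) (auto simp: init d_def indicator_def intro!: ennreal_leI)
    then show ?case by (simp add: emeasure_space_1)
  next
    case (Suc k)
    let ?s = "\<lambda>k. \<Sum>j = 1..k. 1 / real (N j) * c ^ (k - j)"
    \<comment> \<open>Old terms gain one factor \<open>c\<close>; the new one has exponent 0 and
      coefficient one, also when \<open>c = 0\<close>.\<close>
    have s: "?s (Suc k) = c * ?s k + 1 / real (N (Suc k))"
    proof -
      have "(\<Sum>j = 1..k. 1 / real (N j) * c ^ (Suc k - j)) = c * ?s k"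
        unfolding sum_distrib_left by (intro sum.cong) (auto simp: Suc_diff_le)
      then show ?thesis by simp
    qed
    have nn: "0 \<le> c ^ k * d + K * ?s k"
      using c d K by (intro add_nonneg_nonneg mult_nonneg_nonneg sum_nonneg) auto
    have "err (Suc k) \<le> ennreal c * err k + ennreal (K * (1 / real (N (Suc k))))"
      using error_recursion[of l \<psi> \<theta>hat k] assms unfolding err_def c_def K_def by simp
    also have "\<dots> \<le> ennreal c * ennreal (c ^ k * d + K * ?s k) + ennreal (K * (1 / real (N (Suc k))))"
      using Suc.IH by (intro add_right_mono mult_left_mono) auto
    also have "\<dots> = ennreal (c * (c ^ k * d + K * ?s k) + K * (1 / real (N (Suc k))))"
      unfolding ennreal_mult[OF c nn, symmetric]
      by (rule ennreal_plus[symmetric]) (use c K nn in \<open>simp_all only: mult_nonneg_nonneg zero_le_divide_1_iff of_nat_0_le_iff\<close>)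
    also have "c * (c ^ k * d + K * ?s k) + K * (1 / real (N (Suc k))) = c ^ Suc k * d + K * ?s (Suc k)"
      unfolding s by (simp add: algebra_simps)
    finally show ?case .
  qed
  then show ?thesis unfolding err_def c_def K_def d_def by blast
qed

end
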